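(* Let $N\ge 2$ be an integer, $\delta>-1$, and $(c_k)_{k\ge1}$ positive numbers, and consider the random graph $\mathcal G_N$ on $\Omega_N$ in which distinct $x,y$ are joined by an edge independently with probability $\min\!\big(c_k/N^{k(1+\delta)},1\big)$, $k=d(x,y)$. (a) If $\delta>1$ and $\sup_k c_k<\infty$, then percolation does not occur. (b) If $\delta<1$ and $c=\inf_k c_k$ is large enough, then percolation occurs (through a chain of clusters in $k$-balls), and the percolation cluster (the infinite cluster) is unique.
   Context: $\Omega_N$ is the set of sequences $x=(x_1,x_2,\dots)$ with $x_i\in\{0,1,\dots,N-1\}$ and only finitely many $x_i\neq 0$ (a group under componentwise addition mod $N$). The hierarchical distance is $d(x,y)=0$ if $x=y$ and $d(x,y)=\max\{i: x_i\ne y_i\}$ otherwise; it is an ultrametric. $\mathbf 0$ denotes the zero sequence. For $k\ge1$, a $k$-ball is a set $\{y:d(x,y)\le k\}$ (it has $N^k$ points). All edges of $\mathcal G_N$ are independent. A cluster is a connected component of the graph. Percolation is said to occur if, with positive probability, $\mathbf 0$ belongs to an infinite cluster. *)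

theory Defs
  imports "HOL-Probability.Probability"
begin

type_synonym vertex = "nat \<Rightarrow> nat"
type_synonym edge = "vertex set"

text \<open>Omega_N: sequences x_1, x_2, ... with values in {0..N-1}, finitely many nonzero.
  Coordinates are indexed from 1; the unused coordinate 0 is fixed to 0.\<close>
definition Omega :: "nat \<Rightarrow> vertex set" where
  "Omega N = {x. x 0 = 0 \<and> (\<forall>i. x i < N) \<and> finite {i. x i \<noteq> 0}}"

definition zero_seq :: vertex where
  "zero_seq = (\<lambda>_. 0)"

definition hdist :: "vertex \<Rightarrow> vertex \<Rightarrow> nat" where
  "hdist x y = (if x = y then 0 else Max {i. x i \<noteq> y i})"

definition edges :: "nat \<Rightarrow> edge set" where
  "edges N = {{x, y} | x y. x \<in> Omega N \<and> y \<in> Omega N \<and> x \<noteq> y}"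

definition edge_prob :: "nat \<Rightarrow> real \<Rightarrow> (nat \<Rightarrow> real) \<Rightarrow> vertex \<Rightarrow> vertex \<Rightarrow> real" where
  "edge_prob N \<delta> c x y =
     (let k = hdist x y in min (c k / (real N powr (real k * (1 + \<delta>)))) 1)"

text \<open>Probability of an edge given as a set (well defined since edge_prob is symmetric).\<close>
definition edge_set_prob :: "nat \<Rightarrow> real \<Rightarrow> (nat \<Rightarrow> real) \<Rightarrow> edge \<Rightarrow> real" where
  "edge_set_prob N \<delta> c e = (SOME p. \<exists>x y. e = {x, y} \<and> x \<noteq> y \<and> p = edge_prob N \<delta> c x y)"

definition G :: "nat \<Rightarrow> real \<Rightarrow> (nat \<Rightarrow> real) \<Rightarrow> (edge \<Rightarrow> bool) measure" where
  "G N \<delta> c = (\<Pi>\<^sub>M e\<in>edges N. measure_pmf (bernoulli_pmf (edge_set_prob N \<delta> c e)))"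

definition adj :: "nat \<Rightarrow> (edge \<Rightarrow> bool) \<Rightarrow> vertex \<Rightarrow> vertex \<Rightarrow> bool" where
  "adj N \<omega> x y \<longleftrightarrow> {x, y} \<in> edges N \<and> \<omega> {x, y}"

definition cluster :: "nat \<Rightarrow> (edge \<Rightarrow> bool) \<Rightarrow> vertex \<Rightarrow> vertex set" where
  "cluster N \<omega> x = {y. (adj N \<omega>)\<^sup>*\<^sup>* x y}"

definition perc_event :: "nat \<Rightarrow> real \<Rightarrow> (nat \<Rightarrow> real) \<Rightarrow> (edge \<Rightarrow> bool) set" where
  "perc_event N \<delta> c = {\<omega> \<in> space (G N \<delta> c). infinite (cluster N \<omega> zero_seq)}"

end

theory Submission
  imports Defs
begin

text \<open>For \<open>\<delta> > 1\<close> the expected number of edges leaving the \<open>k\<close>-ball around \<open>0\<close> is of order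
  \<open>N\<^bsup>k(1 - \<delta>)\<^esup>\<close>, which tends to \<open>0\<close>.

  For \<open>\<delta> < 1\<close> group \<open>m\<close> levels into one so that \<open>M = N\<^bsup>m\<^esup>\<close> satisfies \<open>(M - 1)\<^sup>2 > M\<^bsup>1 + \<delta>\<^esup>\<close>. A ball of
  level \<open>j + 1\<close> is good if all but at most one of its \<open>M\<close> subballs of level \<open>j\<close> are good and the
  chosen clusters of the good ones are pairwise joined by an edge; the union of these is then its
  chosen cluster, which has at least \<open>(M - 1)\<^bsup>j + 1\<^esup>\<close> points. The expected number of edges between two
  chosen clusters grows geometrically in \<open>j\<close>, so for large \<open>c\<close> the probability \<open>q\<^sub>j\<close> of being bad,
  which satisfies \<open>q\<^bsub>j + 1\<^esub> \<le> M\<^sup>2 (q\<^sub>j\<^sup>2 + \<epsilon>\<^sub>j)\<close>, is summable with a small sum. Hence with probability at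
  least 5/8 all subballs occurring in the balls around \<open>0\<close> are good and linked, and \<open>0\<close> lies in the
  increasing union of the chosen clusters.

  For uniqueness, an infinite cluster leaves every ball around \<open>0\<close>, and each time it does so it has,
  given the edges seen so far, a chance of at least 5/8 to hit the chosen cluster of the ball it enters,
  which on all large scales is linked to the chosen clusters around \<open>0\<close>. Approximating the event
  that an infinite cluster misses these by an event \<open>V\<close> depending on finitely many edges, its
  probability is at most 3/8 of that of \<open>V\<close>, up to a small error, hence it vanishes.\<close>

section \<open>Events depending on few edges\<close>

text \<open>Quantifies over all functions, not only over points of the product space, so
  configurations may be restricted or altered off \<open>S\<close>. The values are arbitrary, since
  set-valued functions such as chosen clusters are covered too.\<close>

definition depends_on :: "'e set \<Rightarrow> (('e \<Rightarrow> bool) \<Rightarrow> 'b) \<Rightarrow> bool" where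
  "depends_on S f \<longleftrightarrow> (\<forall>\<omega> \<omega>'. (\<forall>e\<in>S. \<omega> e = \<omega>' e) \<longrightarrow> f \<omega> = f \<omega>')"

lemma depends_onI: "(\<And>\<omega> \<omega>'. (\<And>e. e \<in> S \<Longrightarrow> \<omega> e = \<omega>' e) \<Longrightarrow> f \<omega> = f \<omega>') \<Longrightarrow> depends_on S f"
  unfolding depends_on_def by blast

lemma depends_onD: "depends_on S f \<Longrightarrow> (\<And>e. e \<in> S \<Longrightarrow> \<omega> e = \<omega>' e) \<Longrightarrow> f \<omega> = f \<omega>'"
  unfolding depends_on_def by blast

lemma depends_on_mono: "depends_on S f \<Longrightarrow> S \<subseteq> T \<Longrightarrow> depends_on T f"
  unfolding depends_on_def by blast

section \<open>Independent Bernoulli variables indexed by a set of edges\<close>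

locale bernoulli_product =
  fixes E :: "'e set" and p :: "'e \<Rightarrow> real"
begin

abbreviation P :: "('e \<Rightarrow> bool) measure" where
  "P \<equiv> \<Pi>\<^sub>M e\<in>E. measure_pmf (bernoulli_pmf (p e))"

sublocale product_prob_space "\<lambda>e. measure_pmf (bernoulli_pmf (p e))" E
  by (intro product_prob_spaceI measure_pmf.prob_space_axioms)

lemma space_P: "space P = E \<rightarrow>\<^sub>E UNIV"
  by (simp add: space_PiM)

lemma pred_component: "e \<in> E \<Longrightarrow> Measurable.pred P (\<lambda>\<omega>. \<omega> e)"
  using measurable_component_singleton[of e E "\<lambda>e. measure_pmf (bernoulli_pmf (p e))"]
  by (simp add: measurable_pmf_measure2)

text \<open>The event is a finite union of cylinders, one for each pattern on \<open>S\<close> that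
  satisfies \<open>\<Phi>\<close>.\<close>

lemma pred_finite:
  assumes "finite S" "S \<subseteq> E" "depends_on S \<Phi>"
  shows "Measurable.pred P \<Phi>"
proof -
  have eq: "{\<omega> \<in> space P. \<Phi> \<omega>} =
      (\<Union>f\<in>{f \<in> S \<rightarrow>\<^sub>E UNIV. \<Phi> f}. {\<omega> \<in> space P. \<forall>e\<in>S. \<omega> e = f e})"
  proof safe
    fix \<omega> assume "\<omega> \<in> space P" "\<Phi> \<omega>"
    moreover from \<open>\<Phi> \<omega>\<close> have "\<Phi> (restrict \<omega> S)"
      using depends_onD[OF assms(3), of \<omega> "restrict \<omega> S"] by auto
    ultimately show "\<omega> \<in> (\<Union>f\<in>{f \<in> S \<rightarrow>\<^sub>E UNIV. \<Phi> f}. {\<omega> \<in> space P. \<forall>e\<in>S. \<omega> e = f e})"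
      by (intro UN_I[of "restrict \<omega> S"]) auto
  next
    fix f \<omega> assume "\<Phi> f" "\<forall>e\<in>S. \<omega> e = f e"
    then show "\<Phi> \<omega>" using depends_onD[OF assms(3), of \<omega> f] by auto
  qed
  have "finite {f \<in> S \<rightarrow>\<^sub>E (UNIV::bool set). \<Phi> f}"
    using assms(1) by (auto intro!: finite_subset[OF _ finite_PiE[of S "\<lambda>_. UNIV"]])
  moreover have "{\<omega> \<in> space P. \<forall>e\<in>S. \<omega> e = f e} \<in> sets P" for f
  proof -
    have [measurable]: "Measurable.pred P (\<lambda>\<omega>. \<omega> e)" if "e \<in> S" for e
      using assms that by (intro pred_component) auto
    note assms(1)[measurable]
    show ?thesis by measurable
  qed
  ultimately show ?thesis
    unfolding pred_def eq by auto
qed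

lemma indep_components:
  assumes "E \<noteq> {}"
  shows "indep_vars (\<lambda>e. measure_pmf (bernoulli_pmf (p e))) (\<lambda>e \<omega>. \<omega> e) E"
proof -
  have "distr P P (\<lambda>x. \<lambda>i\<in>E. x i) = distr P P (\<lambda>x. x)"
    by (intro distr_cong) (auto simp: space_P fun_eq_iff extensional_def PiE_iff)
  also have "\<dots> = (\<Pi>\<^sub>M e\<in>E. distr P (measure_pmf (bernoulli_pmf (p e))) (\<lambda>\<omega>. \<omega> e))"
    by (subst distr_id2[OF refl], rule PiM_cong) (auto simp: PiM_component)
  finally show ?thesis
    using assms by (subst indep_vars_iff_distr_eq_PiM') auto
qed

text \<open>The restrictions of a configuration to the disjoint sets \<open>S\<close> and
  \<open>T\<close> are independent, and each event is a preimage under one of them. As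
  \<open>S\<close> and \<open>T\<close> may be infinite, measurability is assumed
  separately.\<close>

lemma prob_indep:
  assumes "S \<inter> T = {}" "S \<subseteq> E" "T \<subseteq> E" "depends_on S \<Phi>" "depends_on T \<Psi>"
    and "Measurable.pred P \<Phi>" "Measurable.pred P \<Psi>"
  shows "prob {\<omega> \<in> space P. \<Phi> \<omega> \<and> \<Psi> \<omega>} = prob {\<omega> \<in> space P. \<Phi> \<omega>} * prob {\<omega> \<in> space P. \<Psi> \<omega>}"
proof (cases "E = {}")
  case True
  then have c: "\<Phi> \<omega> = \<Phi> \<omega>'" "\<Psi> \<omega> = \<Psi> \<omega>'" for \<omega> \<omega>'
    using assms(2,3) depends_onD[OF assms(4), of \<omega> \<omega>'] depends_onD[OF assms(5), of \<omega> \<omega>'] by auto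
  show ?thesis
  proof (cases "\<Phi> undefined \<and> \<Psi> undefined")
    case True
    then have "\<Phi> \<omega> = True \<and> \<Psi> \<omega> = True" for \<omega> using c[of \<omega> undefined] by auto
    then show ?thesis by (simp add: P.prob_space)
  next
    case False
    then have "(\<forall>\<omega>. \<not> \<Phi> \<omega>) \<or> (\<forall>\<omega>. \<not> \<Psi> \<omega>)"
      using c by metis
    then show ?thesis by auto
  qed
next
  case False
  \<comment> \<open>The event transported to configurations on \<open>S\<close> alone: these are
    extended by \<open>False\<close> off \<open>S\<close>, which \<open>\<Phi>\<close> does not
    notice.\<close>
  define A where "A S \<Phi> = {f \<in> space (\<Pi>\<^sub>M e\<in>S. measure_pmf (bernoulli_pmf (p e))).
      \<Phi> (\<lambda>e\<in>E. e \<in> S \<and> f e)}" for S and \<Phi> :: "('e \<Rightarrow> bool) \<Rightarrow> bool"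
  have A: "A S \<Phi> \<in> sets (\<Pi>\<^sub>M e\<in>S. measure_pmf (bernoulli_pmf (p e)))"
    if "Measurable.pred P \<Phi>" for S \<Phi>
  proof -
    have "(\<lambda>f. \<lambda>e\<in>E. e \<in> S \<and> f e) \<in> measurable (\<Pi>\<^sub>M e\<in>S. measure_pmf (bernoulli_pmf (p e))) P"
    proof (rule measurable_restrict)
      fix e assume "e \<in> E"
      show "(\<lambda>f. e \<in> S \<and> f e) \<in> measurable (\<Pi>\<^sub>M e\<in>S. measure_pmf (bernoulli_pmf (p e))) (measure_pmf (bernoulli_pmf (p e)))"
        using measurable_component_singleton[of e S "\<lambda>e. measure_pmf (bernoulli_pmf (p e))"]
        by (cases "e \<in> S") (auto simp: measurable_pmf_measure2)
    qed
    from measurable_compose[OF this that] show ?thesis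
      unfolding A_def pred_def[symmetric] .
  qed
  have ext: "{\<omega> \<in> space P. restrict \<omega> S \<in> A S \<Phi>} = {\<omega> \<in> space P. \<Phi> \<omega>}" if "S \<subseteq> E" "depends_on S \<Phi>" for S \<Phi>
  proof -
    have "\<Phi> (\<lambda>e\<in>E. e \<in> S \<and> restrict \<omega> S e) = \<Phi> \<omega>" for \<omega>
      by (rule depends_onD[OF that(2)]) (use that(1) in auto)
    then show ?thesis by (auto simp: A_def space_PiM)
  qed
  note iv = indep_varD[OF indep_var_restrict[OF indep_components[OF False] assms(1-3)] A[OF assms(6)] A[OF assms(7)]]
  have "prob {\<omega> \<in> space P. \<Phi> \<omega> \<and> \<Psi> \<omega>} = prob ((\<lambda>\<omega>. (restrict \<omega> S, restrict \<omega> T)) -` (A S \<Phi> \<times> A T \<Psi>) \<inter> space P)"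
    using ext[OF assms(2,4)] ext[OF assms(3,5)] by (intro arg_cong[where f=prob]) blast
  also have "\<dots> = prob ((\<lambda>\<omega>. restrict \<omega> S) -` (A S \<Phi>) \<inter> space P) * prob ((\<lambda>\<omega>. restrict \<omega> T) -` (A T \<Psi>) \<inter> space P)"
    using iv by simp
  also have "(\<lambda>\<omega>. restrict \<omega> S) -` (A S \<Phi>) \<inter> space P = {\<omega> \<in> space P. \<Phi> \<omega>}"
    using ext[OF assms(2,4)] by blast
  also have "(\<lambda>\<omega>. restrict \<omega> T) -` (A T \<Psi>) \<inter> space P = {\<omega> \<in> space P. \<Psi> \<omega>}"
    using ext[OF assms(3,5)] by blast
  finally show ?thesis .
qed

lemma prob_all_closed:
  assumes "finite S" "S \<subseteq> E" "\<And>e. e \<in> S \<Longrightarrow> 0 \<le> p e \<and> p e \<le> 1"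
  shows "prob {\<omega> \<in> space P. \<forall>e\<in>S. \<not> \<omega> e} = (\<Prod>e\<in>S. 1 - p e)"
proof -
  have "{\<omega> \<in> space P. \<forall>e\<in>S. \<not> \<omega> e} = {\<omega> \<in> space P. \<forall>e\<in>S. \<omega> e \<in> {False}}" by auto
  then have "emeasure P {\<omega> \<in> space P. \<forall>e\<in>S. \<not> \<omega> e} = (\<Prod>e\<in>S. emeasure (measure_pmf (bernoulli_pmf (p e))) {False})"
    using emeasure_PiM_Collect[OF assms(2,1), of "\<lambda>_. {False}"] by simp
  also have "\<dots> = (\<Prod>e\<in>S. ennreal (1 - p e))"
    using assms(3) by (intro prod.cong) (auto simp: emeasure_pmf_single)
  also have "\<dots> = ennreal (\<Prod>e\<in>S. 1 - p e)"
    using assms(3) by (intro prod_ennreal) auto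
  finally show ?thesis
    using assms(3) by (simp add: measure_def prod_nonneg)
qed

lemma prob_open:
  assumes "e \<in> E" "0 \<le> p e" "p e \<le> 1"
  shows "prob {\<omega> \<in> space P. \<omega> e} = p e"
proof -
  have "{\<omega> \<in> space P. \<omega> e} = {\<omega> \<in> space P. \<omega> e \<in> {True}}" by auto
  then have "emeasure P {\<omega> \<in> space P. \<omega> e} = ennreal (p e)"
    using emeasure_PiM_Collect_single[of e "{True}"] assms by (simp add: emeasure_pmf_single)
  then show ?thesis using assms by (simp add: measure_def)
qed

text \<open>The approximable sets form a sigma-algebra, since a countable union is up to a small
  error a finite one.\<close>

lemma approx_by_finite:
  assumes "A \<in> sets P" "\<epsilon> > 0"
  shows "\<exists>S \<Phi>. finite S \<and> S \<subseteq> E \<and> depends_on S \<Phi> \<and>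
    prob {\<omega> \<in> space P. \<Phi> \<omega> \<noteq> (\<omega> \<in> A)} < \<epsilon>"
proof -
  have m: "{\<omega> \<in> space P. \<Phi> \<omega> \<noteq> (\<omega> \<in> A)} \<in> sets P" if "finite S" "S \<subseteq> E" "depends_on S \<Phi>" "A \<in> sets P" for S \<Phi> A
    using pred_finite[OF that(1-3)] that(4) by measurable
  from assms(1) have "A \<in> sigma_sets (\<Pi>\<^sub>E i\<in>E. UNIV) {{f\<in>\<Pi>\<^sub>E i\<in>E. UNIV. f i \<in> A} | i A. i \<in> E}"
    (is "_ \<in> sigma_sets ?U ?R") by (simp add: sets_PiM_single)
  then show ?thesis using \<open>\<epsilon> > 0\<close>
  proof (induction arbitrary: \<epsilon>)
    case (Basic a)
    then obtain i B where i: "i \<in> E" and a: "a = {f \<in> \<Pi>\<^sub>E i\<in>E. UNIV. f i \<in> B}" by auto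
    have "{\<omega> \<in> space P. (\<omega> i \<in> B) \<noteq> (\<omega> \<in> a)} = {}" by (auto simp: a space_P)
    then have "prob {\<omega> \<in> space P. (\<omega> i \<in> B) \<noteq> (\<omega> \<in> a)} < \<epsilon>"
      using Basic(2) by (simp only: measure_empty)
    moreover have "depends_on {i} (\<lambda>\<omega>. \<omega> i \<in> B)" by (simp add: depends_on_def)
    moreover have "finite {i}" "{i} \<subseteq> E" using i by auto
    ultimately show ?case by blast
  next
    case Empty
    have "depends_on {} (\<lambda>\<omega>::'e \<Rightarrow> bool. False)" by (simp add: depends_on_def)
    moreover have "prob {\<omega> \<in> space P. False \<noteq> (\<omega> \<in> {})} < \<epsilon>" using Empty by simp
    ultimately show ?case by blast
  next
    case (Compl a)
    then obtain S \<Phi> where S: "finite S" "S \<subseteq> E" "depends_on S \<Phi>"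
      "prob {\<omega> \<in> space P. \<Phi> \<omega> \<noteq> (\<omega> \<in> a)} < \<epsilon>" by blast
    have "{\<omega> \<in> space P. (\<not> \<Phi> \<omega>) \<noteq> (\<omega> \<in> ?U - a)} = {\<omega> \<in> space P. \<Phi> \<omega> \<noteq> (\<omega> \<in> a)}"
      by (auto simp: space_P)
    with S(4) have "prob {\<omega> \<in> space P. (\<not> \<Phi> \<omega>) \<noteq> (\<omega> \<in> ?U - a)} < \<epsilon>" by (simp only:)
    moreover have "depends_on S (\<lambda>\<omega>. \<not> \<Phi> \<omega>)"
      using S(3) unfolding depends_on_def by blast
    ultimately show ?case using S(1,2)
      by (intro exI[of _ S] exI[of _ "\<lambda>\<omega>. \<not> \<Phi> \<omega>"] conjI)
  next
    case (Union a)
    have a[measurable]: "a i \<in> sets P" for i using Union(1)[of i] by (simp add: sets_PiM_single)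
    have "(\<lambda>n. prob (\<Union>i<n. a i)) \<longlonglongrightarrow> prob (\<Union>n. \<Union>i<n. a i)"
      by (intro finite_Lim_measure_incseq) (auto simp: incseq_def, metis lessThan_iff order.strict_trans2)
    also have "(\<Union>n. \<Union>i<n. a i) = (\<Union>i. a i)" by auto
    finally have "eventually (\<lambda>n. dist (prob (\<Union>i<n. a i)) (prob (\<Union>i. a i)) < \<epsilon>/2) sequentially"
      by (rule tendstoD) (use Union in auto)
    then obtain n where n: "dist (prob (\<Union>i<n. a i)) (prob (\<Union>i. a i)) < \<epsilon>/2"
      by (auto simp: eventually_sequentially)
    \<comment> \<open>Half of \<open>\<epsilon>\<close> pays for truncating the union at
      \<open>n\<close>, the other half is shared by the \<open>n\<close> approximations;
      \<open>n + 1\<close> avoids division by zero.\<close>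
    have "\<forall>i. \<exists>S \<Phi>. finite S \<and> S \<subseteq> E \<and> depends_on S \<Phi> \<and>
      prob {\<omega> \<in> space P. \<Phi> \<omega> \<noteq> (\<omega> \<in> a i)} < \<epsilon> / (2 * (real n + 1))"
      using Union(2)[of "\<epsilon> / (2 * (real n + 1))"] Union(3) by auto
    from choice[OF this] obtain S where "\<forall>i. \<exists>\<Phi>. finite (S i) \<and> S i \<subseteq> E \<and> depends_on (S i) \<Phi> \<and>
      prob {\<omega> \<in> space P. \<Phi> \<omega> \<noteq> (\<omega> \<in> a i)} < \<epsilon> / (2 * (real n + 1))" by blast
    from choice[OF this] obtain \<Phi> where S: "\<And>i. finite (S i)" "\<And>i. S i \<subseteq> E" "\<And>i. depends_on (S i) (\<Phi> i)"
      "\<And>i. prob {\<omega> \<in> space P. \<Phi> i \<omega> \<noteq> (\<omega> \<in> a i)} < \<epsilon> / (2 * (real n + 1))" by blast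
    have mm: "{\<omega> \<in> space P. \<Phi> i \<omega> \<noteq> (\<omega> \<in> a i)} \<in> sets P" for i
      by (rule m[OF S(1-3) a])
    let ?\<Phi> = "\<lambda>\<omega>. \<exists>i<n. \<Phi> i \<omega>"
    have "prob {\<omega> \<in> space P. ?\<Phi> \<omega> \<noteq> (\<omega> \<in> (\<Union>i. a i))}
      \<le> prob ((\<Union>i<n. {\<omega> \<in> space P. \<Phi> i \<omega> \<noteq> (\<omega> \<in> a i)}) \<union> ((\<Union>i. a i) - (\<Union>i<n. a i)))"
      using mm by (intro finite_measure_mono) auto
    also have "\<dots> \<le> prob (\<Union>i<n. {\<omega> \<in> space P. \<Phi> i \<omega> \<noteq> (\<omega> \<in> a i)}) + prob ((\<Union>i. a i) - (\<Union>i<n. a i))"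
      using mm by (intro measure_Un_le) auto
    finally have 1: "prob {\<omega> \<in> space P. ?\<Phi> \<omega> \<noteq> (\<omega> \<in> (\<Union>i. a i))} \<le> \<dots>" .
    have "prob ((\<Union>i. a i) - (\<Union>i<n. a i)) = prob (\<Union>i. a i) - prob (\<Union>i<n. a i)"
      by (rule finite_measure_Diff) auto
    then have 2: "prob ((\<Union>i. a i) - (\<Union>i<n. a i)) < \<epsilon>/2"
      using n unfolding dist_real_def by arith
    have "prob (\<Union>i<n. {\<omega> \<in> space P. \<Phi> i \<omega> \<noteq> (\<omega> \<in> a i)})
      \<le> (\<Sum>i<n. prob {\<omega> \<in> space P. \<Phi> i \<omega> \<noteq> (\<omega> \<in> a i)})"
      using mm by (intro finite_measure_subadditive_finite) auto
    also have "\<dots> \<le> (\<Sum>i<n. \<epsilon> / (2 * (real n + 1)))"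
      using S(4) by (intro sum_mono less_imp_le)
    also have "\<dots> \<le> \<epsilon> / 2" using Union(3) by (simp add: field_simps)
    finally have "prob {\<omega> \<in> space P. ?\<Phi> \<omega> \<noteq> (\<omega> \<in> (\<Union>i. a i))} < \<epsilon>"
      using 1 2 by linarith
    moreover have "depends_on (\<Union>i<n. S i) ?\<Phi>"
      unfolding depends_on_def
    proof (intro allI impI)
      fix \<omega> \<omega>' :: "'e \<Rightarrow> bool" assume "\<forall>e\<in>\<Union> (S ` {..<n}). \<omega> e = \<omega>' e"
      then have "\<Phi> i \<omega> = \<Phi> i \<omega>'" if "i < n" for i
        using that by (intro depends_onD[OF S(3)]) auto
      then show "(\<exists>i<n. \<Phi> i \<omega>) = (\<exists>i<n. \<Phi> i \<omega>')" by auto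
    qed
    moreover have "finite (\<Union>i<n. S i)" "(\<Union>i<n. S i) \<subseteq> E" using S(1,2) by auto
    ultimately show ?case by (intro exI[of _ "\<Union>i<n. S i"] exI[of _ ?\<Phi>] conjI)
  qed
qed

end

section \<open>Hierarchical balls and clusters\<close>

text \<open>For \<open>x\<close> in \<open>Omega N\<close> this is the ball of radius
  \<open>k\<close> in \<open>hdist\<close>. In coordinates it is a class of the relation "equal
  beyond \<open>k\<close>", which makes the ultrametric properties immediate.\<close>

definition hball :: "nat \<Rightarrow> nat \<Rightarrow> vertex \<Rightarrow> vertex set" where
  "hball N k x = {y \<in> Omega N. \<forall>i>k. y i = x i}"

text \<open>For \<open>a \<le> b\<close>, one canonical representative of each \<open>a\<close>-ball
  inside the \<open>b\<close>-ball. With \<open>a = 0\<close> it is the whole ball, as coordinate 0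
  always vanishes.\<close>

definition block :: "nat \<Rightarrow> nat \<Rightarrow> nat \<Rightarrow> vertex \<Rightarrow> vertex set" where
  "block N a b x = {y \<in> hball N b x. \<forall>i\<le>a. y i = 0}"

lemma hball_subset_Omega: "hball N k x \<subseteq> Omega N"
  by (auto simp: hball_def)

lemma hball_self: "x \<in> Omega N \<Longrightarrow> x \<in> hball N k x"
  by (auto simp: hball_def)

lemma hball_cong: "y \<in> hball N k x \<Longrightarrow> hball N k y = hball N k x"
  by (auto simp: hball_def)

lemma hball_mono: "k \<le> l \<Longrightarrow> hball N k x \<subseteq> hball N l x"
  by (auto simp: hball_def)

lemma hball_0: "x \<in> Omega N \<Longrightarrow> hball N 0 x = {x}"
  by (auto simp: hball_def Omega_def fun_eq_iff) (metis gr0I)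

lemma zero_in_Omega: "N \<ge> 1 \<Longrightarrow> zero_seq \<in> Omega N"
  by (auto simp: Omega_def zero_seq_def)

text \<open>Only the digits at positions \<open>a + 1\<close> to \<open>b\<close> are free;
  \<open>h\<close> splices them between the zeros below and the digits of \<open>x\<close>
  above.\<close>

lemma card_block:
  assumes x: "x \<in> Omega N" and "a \<le> b"
  shows "finite (block N a b x)" "card (block N a b x) = N ^ (b - a)"
proof -
  define h where "h f = (\<lambda>i. if i \<le> a then 0 else if i \<le> b then f i else x i)" for f :: vertex
  have N: "N > 0" using x by (auto simp: Omega_def intro: gr0I)
  have "bij_betw h ({a<..b} \<rightarrow>\<^sub>E {..<N}) (block N a b x)"
    unfolding bij_betw_def
  proof safe
    show "inj_on h ({a<..b} \<rightarrow>\<^sub>E {..<N})"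
    proof (rule inj_onI)
      fix f g assume f: "f \<in> {a<..b} \<rightarrow>\<^sub>E {..<N}" and g: "g \<in> {a<..b} \<rightarrow>\<^sub>E {..<N}" and eq: "h f = h g"
      show "f = g"
      proof (rule PiE_ext[OF f g])
        fix i assume "i \<in> {a<..b}"
        then show "f i = g i" using fun_cong[OF eq, of i] by (auto simp: h_def)
      qed
    qed
  next
    fix f assume f: "f \<in> {a<..b} \<rightarrow>\<^sub>E {..<N}"
    have "finite ({..b} \<union> {i. x i \<noteq> 0})" using x by (auto simp: Omega_def)
    then have "finite {i. h f i \<noteq> 0}"
      by (rule rev_finite_subset) (auto simp: h_def split: if_splits)
    moreover have "h f i < N" for i
      using f x N by (auto simp: h_def Omega_def PiE_iff)
    ultimately show "h f \<in> block N a b x"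
      using \<open>a \<le> b\<close> by (auto simp: block_def hball_def Omega_def h_def)
  next
    fix y assume y: "y \<in> block N a b x"
    have "y = h (restrict y {a<..b})"
      using y by (auto simp: h_def block_def hball_def fun_eq_iff)
    moreover have "restrict y {a<..b} \<in> {a<..b} \<rightarrow>\<^sub>E {..<N}"
      using y by (auto simp: block_def hball_def Omega_def)
    ultimately show "y \<in> h ` ({a<..b} \<rightarrow>\<^sub>E {..<N})" by blast
  qed
  from bij_betw_same_card[OF this] bij_betw_finite[OF this]
  show "finite (block N a b x)" "card (block N a b x) = N ^ (b - a)"
    by (auto simp: card_PiE intro!: finite_PiE)
qed

lemma hball_eq_block: "hball N k x = block N 0 k x"
  by (auto simp: hball_def block_def Omega_def)

lemma card_hball:
  assumes "x \<in> Omega N"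
  shows "finite (hball N k x)" "card (hball N k x) = N ^ k"
  using card_block[OF assms, of 0 k] by (auto simp: hball_eq_block)

lemma Omega_eq_UN_hball:
  assumes "x \<in> Omega N"
  shows "Omega N = (\<Union>k. hball N k x)"
proof safe
  fix y assume y: "y \<in> Omega N"
  have "finite ({i. x i \<noteq> 0} \<union> {i. y i \<noteq> 0})" using assms y by (auto simp: Omega_def)
  then obtain k where k: "\<And>i. i \<in> {i. x i \<noteq> 0} \<union> {i. y i \<noteq> 0} \<Longrightarrow> i \<le> k"
    unfolding finite_nat_set_iff_bounded_le by blast
  have "y \<in> hball N k x"
    using y k by (auto simp: hball_def) (metis not_le not_gr0)
  then show "y \<in> (\<Union>k. hball N k x)" by blast
qed (use hball_subset_Omega in blast)

lemma countable_Omega: "countable (Omega N)"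
proof (cases "Omega N = {}")
  case False
  then obtain x where x: "x \<in> Omega N" by blast
  have "countable (\<Union>k. hball N k x)"
    using card_hball(1)[OF x] by (simp add: countable_finite)
  then show ?thesis using Omega_eq_UN_hball[OF x] by simp
qed auto

lemma finite_subset_hball:
  assumes "x \<in> Omega N" "finite A" "A \<subseteq> Omega N"
  shows "\<exists>k. A \<subseteq> hball N k x"
proof -
  have "\<forall>y\<in>A. \<exists>k. y \<in> hball N k x"
    using assms Omega_eq_UN_hball[OF assms(1)] by blast
  then obtain f where f: "\<And>y. y \<in> A \<Longrightarrow> y \<in> hball N (f y) x" by metis
  have "y \<in> hball N (Max (f ` A)) x" if "y \<in> A" for y
    using f[OF that] hball_mono[of "f y" "Max (f ` A)" N x] assms(2) that by auto
  then show ?thesis by blast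
qed

lemma hdist_props:
  assumes "x \<in> Omega N" "y \<in> Omega N" "x \<noteq> y"
  shows hdist_ge_1: "hdist x y \<ge> 1" and in_hball_hdist: "y \<in> hball N (hdist x y) x"
    and hdist_le: "y \<in> hball N k x \<Longrightarrow> hdist x y \<le> k"
proof -
  have "finite ({i. x i \<noteq> 0} \<union> {i. y i \<noteq> 0})" using assms by (auto simp: Omega_def)
  then have fin: "finite {i. x i \<noteq> y i}" by (rule rev_finite_subset) auto
  obtain i where i: "x i \<noteq> y i" using assms(3) by auto
  then have ne: "{i. x i \<noteq> y i} \<noteq> {}" by auto
  have h: "hdist x y = Max {i. x i \<noteq> y i}" using assms(3) by (simp add: hdist_def)
  \<comment> \<open>Coordinate 0 is constant on \<open>Omega N\<close>, so a differing coordinate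
    has index at least 1.\<close>
  have "x 0 = y 0" using assms by (simp add: Omega_def)
  then have "i \<noteq> 0" using i by metis
  moreover have "i \<le> hdist x y" using fin i by (simp add: h)
  ultimately show "hdist x y \<ge> 1" by simp
  have "x i = y i" if "i > hdist x y" for i
    using Max_ge[OF fin, of i] that by (force simp: h)
  then show "y \<in> hball N (hdist x y) x" using assms by (auto simp: hball_def)
  show "hdist x y \<le> k" if "y \<in> hball N k x"
    unfolding h using fin ne that by (auto simp: hball_def) (metis not_le)
qed

section \<open>Edge probabilities as functions of unordered pairs\<close>

lemma edge_prob_sym: "edge_prob N \<delta> c x y = edge_prob N \<delta> c y x"
proof -
  have "hdist x y = hdist y x"
    by (simp add: hdist_def eq_commute)
  then show ?thesis by (simp add: edge_prob_def)
qed

text \<open>By symmetry both orderings of the endpoints give the same value, so the choice by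
  \<open>SOME\<close> is unambiguous.\<close>

lemma edge_set_prob_eq:
  assumes "x \<noteq> y"
  shows "edge_set_prob N \<delta> c {x, y} = edge_prob N \<delta> c x y"
  unfolding edge_set_prob_def
proof (rule some_equality)
  fix q assume "\<exists>u v. {x, y} = {u, v} \<and> u \<noteq> v \<and> q = edge_prob N \<delta> c u v"
  then show "q = edge_prob N \<delta> c x y"
    by (auto simp: doubleton_eq_iff edge_prob_sym)
qed (use assms in blast)

lemma in_edges_iff: "{x, y} \<in> edges N \<longleftrightarrow> x \<in> Omega N \<and> y \<in> Omega N \<and> x \<noteq> y"
  by (auto simp: edges_def doubleton_eq_iff)

section \<open>Open clusters: closure properties, measurability, exit from a set\<close>

lemma adj_sym: "adj N \<omega> x y \<Longrightarrow> adj N \<omega> y x"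
  by (simp add: adj_def insert_commute)

lemma adjD: "adj N \<omega> x y \<Longrightarrow> x \<in> Omega N \<and> y \<in> Omega N \<and> x \<noteq> y"
  by (simp add: adj_def in_edges_iff)

lemma cluster_self: "x \<in> cluster N \<omega> x"
  by (simp add: cluster_def)

lemma cluster_sym: "y \<in> cluster N \<omega> x \<Longrightarrow> x \<in> cluster N \<omega> y"
  unfolding cluster_def by (metis adj_sym mem_Collect_eq sympD sympI symp_rtranclp)

lemma cluster_trans: "y \<in> cluster N \<omega> x \<Longrightarrow> z \<in> cluster N \<omega> y \<Longrightarrow> z \<in> cluster N \<omega> x"
  unfolding cluster_def by auto

lemma cluster_eq: "y \<in> cluster N \<omega> x \<Longrightarrow> cluster N \<omega> y = cluster N \<omega> x"
  by (metis cluster_sym cluster_trans subsetI subset_antisym)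

lemma adj_in_cluster: "adj N \<omega> x y \<Longrightarrow> y \<in> cluster N \<omega> x"
  by (simp add: cluster_def r_into_rtranclp)

lemma cluster_mono: "(\<And>e. \<omega> e \<Longrightarrow> \<omega>' e) \<Longrightarrow> cluster N \<omega> x \<subseteq> cluster N \<omega>' x"
  unfolding cluster_def by (auto elim!: rtranclp_mono[THEN predicate2D, rotated] simp: adj_def)

lemma cluster_subset: "x \<in> Omega N \<Longrightarrow> cluster N \<omega> x \<subseteq> Omega N"
  unfolding cluster_def
proof safe
  fix y assume "(adj N \<omega>)\<^sup>*\<^sup>* x y" "x \<in> Omega N"
  then show "y \<in> Omega N" by (induction) (auto dest: adjD)
qed

text \<open>Reachability is a countable union over path lengths and intermediate vertices. The map
  \<open>g\<close> admits thinned configurations, such as those that keep only the edges meeting a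
  ball.\<close>

lemma pred_cluster:
  assumes "\<And>e. e \<in> edges N \<Longrightarrow> Measurable.pred M (\<lambda>\<omega>. g \<omega> e)"
  shows "Measurable.pred M (\<lambda>\<omega>. y \<in> cluster N (g \<omega>) x)"
proof -
  have a[measurable]: "Measurable.pred M (\<lambda>\<omega>. adj N (g \<omega>) x y)" for x y
    using assms[of "{x, y}"] by (cases "{x, y} \<in> edges N") (auto simp: adj_def)
  have b: "Measurable.pred M (\<lambda>\<omega>. (adj N (g \<omega>) ^^ n) x y)" for n y
  proof (induction n arbitrary: y)
    case 0
    then show ?case by simp
  next
    case (Suc n)
    note Suc[measurable]
    have "(adj N (g \<omega>) ^^ Suc n) x y \<longleftrightarrow> (\<exists>z\<in>Omega N. (adj N (g \<omega>) ^^ n) x z \<and> adj N (g \<omega>) z y)" for \<omega>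
      by (auto dest: adjD)
    moreover note countable_Omega[measurable]
    ultimately show ?case by simp
  qed
  have "y \<in> cluster N (g \<omega>) x \<longleftrightarrow> (\<exists>n. (adj N (g \<omega>) ^^ n) x y)" for \<omega>
    unfolding cluster_def by (simp add: rtranclp_power)
  with b show ?thesis by simp
qed

text \<open>Balls are finite and exhaust \<open>Omega N\<close>. The right-hand side is a countable
  condition and so yields measurability.\<close>

lemma infinite_cluster_iff:
  assumes x: "x \<in> Omega N"
  shows "infinite (cluster N \<omega> x) \<longleftrightarrow> (\<forall>k. \<exists>y\<in>Omega N. y \<notin> hball N k x \<and> y \<in> cluster N \<omega> x)"
proof
  assume "infinite (cluster N \<omega> x)"
  then have "\<not> cluster N \<omega> x \<subseteq> hball N k x" for k
    using card_hball(1)[OF x] finite_subset by blast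
  then show "\<forall>k. \<exists>y\<in>Omega N. y \<notin> hball N k x \<and> y \<in> cluster N \<omega> x"
    using cluster_subset[OF x] by blast
next
  assume r: "\<forall>k. \<exists>y\<in>Omega N. y \<notin> hball N k x \<and> y \<in> cluster N \<omega> x"
  show "infinite (cluster N \<omega> x)"
  proof
    assume "finite (cluster N \<omega> x)"
    then obtain k where "cluster N \<omega> x \<subseteq> hball N k x"
      using finite_subset_hball[OF x _ cluster_subset[OF x]] by blast
    with r show False by blast
  qed
qed

lemma pred_infinite_cluster:
  assumes "x \<in> Omega N" "\<And>e. e \<in> edges N \<Longrightarrow> Measurable.pred M (\<lambda>\<omega>. \<omega> e)"
  shows "Measurable.pred M (\<lambda>\<omega>. infinite (cluster N \<omega> x))"
  unfolding infinite_cluster_iff[OF assms(1)]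
proof -
  note countable_Omega[measurable] pred_cluster[where g="\<lambda>\<omega>. \<omega>", OF assms(2), measurable]
  show "Measurable.pred M (\<lambda>\<omega>. \<forall>k. \<exists>y\<in>Omega N. y \<notin> hball N k x \<and> y \<in> cluster N \<omega> x)"
    by measurable
qed

text \<open>Follow an open path up to its first vertex \<open>z\<close> outside \<open>A\<close>:
  every edge used, including the last one, meets \<open>A\<close>. Hence the exit vertex is found
  without looking at edges that miss \<open>A\<close>.\<close>

lemma cluster_exit:
  assumes "x \<in> A" "y \<in> cluster N \<omega> x" "y \<notin> A"
  shows "\<exists>u\<in>A. \<exists>z\<in>Omega N - A. adj N \<omega> u z \<and> z \<in> cluster N (\<lambda>e. \<omega> e \<and> e \<inter> A \<noteq> {}) x"
proof -
  have "(adj N \<omega>)\<^sup>*\<^sup>* x y" using assms(2) by (simp add: cluster_def)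
  \<comment> \<open>Invariant along the path: either it is still inside \<open>A\<close> and uses
    only edges meeting \<open>A\<close>, or an exit has already been found.\<close>
  then have "(y \<in> A \<and> y \<in> cluster N (\<lambda>e. \<omega> e \<and> e \<inter> A \<noteq> {}) x) \<or>
    (\<exists>u\<in>A. \<exists>z\<in>Omega N - A. adj N \<omega> u z \<and> z \<in> cluster N (\<lambda>e. \<omega> e \<and> e \<inter> A \<noteq> {}) x)"
  proof (induction)
    case base
    then show ?case using assms(1) by (simp add: cluster_self)
  next
    case (step y z)
    show ?case
    proof (cases "y \<in> A \<and> y \<in> cluster N (\<lambda>e. \<omega> e \<and> e \<inter> A \<noteq> {}) x")
      case True
      then have "adj N (\<lambda>e. \<omega> e \<and> e \<inter> A \<noteq> {}) y z" using step(2) by (auto simp: adj_def)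
      then have "z \<in> cluster N (\<lambda>e. \<omega> e \<and> e \<inter> A \<noteq> {}) x"
        using True cluster_trans adj_in_cluster by blast
      then show ?thesis using True step(2) adjD[OF step(2)] by blast
    qed (use step in blast)
  qed
  with assms(3) show ?thesis by blast
qed

section \<open>Absence of percolation\<close>

locale hierarchical =
  fixes N :: nat and \<delta> :: real and c :: "nat \<Rightarrow> real"
  assumes N2: "N \<ge> 2" and c_pos: "\<And>k. k \<ge> 1 \<Longrightarrow> c k > 0"
begin

sublocale bernoulli_product "edges N" "edge_set_prob N \<delta> c" .

lemma G_eq: "G N \<delta> c = P"
  by (simp add: G_def)

lemma zero_Omega [simp]: "zero_seq \<in> Omega N"
  using N2 by (intro zero_in_Omega) auto

lemma edge_prob_bounds:
  assumes "x \<in> Omega N" "y \<in> Omega N" "x \<noteq> y"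
  shows "0 \<le> edge_set_prob N \<delta> c {x, y}" "edge_set_prob N \<delta> c {x, y} \<le> 1"
  using c_pos[OF hdist_ge_1[OF assms]] by (auto simp: edge_set_prob_eq[OF assms(3)] edge_prob_def Let_def)

lemma pred_in_cluster [measurable]: "Measurable.pred P (\<lambda>\<omega>. y \<in> cluster N \<omega> x)"
  by (rule pred_cluster[where g="\<lambda>\<omega>. \<omega>"]) (rule pred_component)

lemma pred_infinite [measurable]: "x \<in> Omega N \<Longrightarrow> Measurable.pred P (\<lambda>\<omega>. infinite (cluster N \<omega> x))"
  by (rule pred_infinite_cluster) (auto intro: pred_component)

lemma perc_event_sets: "perc_event N \<delta> c \<in> sets P"
  using pred_infinite[OF zero_Omega] by (simp add: perc_event_def G_eq pred_def)

text \<open>Union bound: at most \<open>N^k N^j\<close> pairs, each open with probability at most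
  \<open>B N^(-j (1 + \<delta>))\<close>.\<close>

lemma prob_long_edge_le:
  fixes k :: nat
  assumes B: "\<And>k. k \<ge> 1 \<Longrightarrow> c k \<le> B" and "j \<ge> 1"
  defines "A \<equiv> (\<Union>u\<in>hball N k zero_seq. \<Union>y\<in>{y \<in> hball N j zero_seq. u \<noteq> y \<and> hdist u y = j}.
    {\<omega> \<in> space P. \<omega> {u, y}})"
  shows "A \<in> sets P" "prob A \<le> real N ^ k * B * (real N powr - \<delta>) ^ j"
proof -
  have fin: "finite (hball N k zero_seq)" "finite {y \<in> hball N j zero_seq. u \<noteq> y \<and> hdist u y = j}" for u
    by (simp_all add: card_hball(1))
  have B0: "B > 0" using B[of 1] c_pos[of 1] by simp
  have e: "{\<omega> \<in> space P. \<omega> {u, y}} \<in> sets P \<and>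
      prob {\<omega> \<in> space P. \<omega> {u, y}} \<le> B / real N powr (real j * (1 + \<delta>))"
    if "u \<in> hball N k zero_seq" "y \<in> {y \<in> hball N j zero_seq. u \<noteq> y \<and> hdist u y = j}" for u y
  proof
    have uy: "u \<in> Omega N" "y \<in> Omega N" "u \<noteq> y" "hdist u y = j"
      using that hball_subset_Omega by auto
    then have ed: "{u, y} \<in> edges N" by (simp add: in_edges_iff)
    show "{\<omega> \<in> space P. \<omega> {u, y}} \<in> sets P"
      using pred_component[OF ed] by (simp add: pred_def)
    have "prob {\<omega> \<in> space P. \<omega> {u, y}} = edge_set_prob N \<delta> c {u, y}"
      by (rule prob_open[OF ed edge_prob_bounds[OF uy(1-3)]])
    also have "\<dots> \<le> c j / real N powr (real j * (1 + \<delta>))"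
      by (simp add: edge_set_prob_eq[OF uy(3)] edge_prob_def uy(4))
    also have "\<dots> \<le> B / real N powr (real j * (1 + \<delta>))"
      using B[OF \<open>j \<ge> 1\<close>] by (intro divide_right_mono) auto
    finally show "prob {\<omega> \<in> space P. \<omega> {u, y}} \<le> B / real N powr (real j * (1 + \<delta>))" .
  qed
  then show "A \<in> sets P"
    unfolding A_def using fin by (intro sets.finite_UN) auto
  have "prob A \<le> (\<Sum>u\<in>hball N k zero_seq. prob (\<Union>y\<in>{y \<in> hball N j zero_seq. u \<noteq> y \<and> hdist u y = j}.
    {\<omega> \<in> space P. \<omega> {u, y}}))"
    unfolding A_def using e fin by (intro measure_UNION_le sets.finite_UN) auto
  also have "\<dots> \<le> (\<Sum>u\<in>hball N k zero_seq. \<Sum>y\<in>{y \<in> hball N j zero_seq. u \<noteq> y \<and> hdist u y = j}.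
    prob {\<omega> \<in> space P. \<omega> {u, y}})"
    using e fin by (intro sum_mono measure_UNION_le) auto
  also have "\<dots> \<le> (\<Sum>u\<in>hball N k zero_seq. \<Sum>y\<in>{y \<in> hball N j zero_seq. u \<noteq> y \<and> hdist u y = j}.
    B / real N powr (real j * (1 + \<delta>)))"
    using e by (intro sum_mono) auto
  \<comment> \<open>The vertices at distance exactly \<open>j\<close> are bounded by the whole
    \<open>j\<close>-ball.\<close>
  also have "\<dots> \<le> (\<Sum>u\<in>hball N k zero_seq. \<Sum>y\<in>hball N j zero_seq. B / real N powr (real j * (1 + \<delta>)))"
    using B0 by (intro sum_mono sum_mono2) (auto simp: card_hball(1))
  also have "\<dots> = real N ^ k * (real N ^ j * (B / real N powr (real j * (1 + \<delta>))))"
    by (simp add: card_hball(2))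
  also have "real N powr (real j * (1 + \<delta>)) = real N ^ j * real N powr (real j * \<delta>)"
    using N2 by (simp add: distrib_left powr_add powr_realpow)
  also have "real N ^ k * (real N ^ j * (B / (real N ^ j * real N powr (real j * \<delta>)))) =
      real N ^ k * B * (real N powr - (real j * \<delta>))"
    using N2 by (simp add: powr_minus_divide)
  also have "real N powr - (real j * \<delta>) = (real N powr - \<delta>) ^ j"
    using N2 by (simp add: powr_powr mult.commute flip: powr_realpow)
  finally show "prob A \<le> real N ^ k * B * (real N powr - \<delta>) ^ j" .
qed

text \<open>An infinite cluster at 0 needs an edge out of every \<open>k\<close>-ball. Summing the
  previous bound over lengths \<open>j > k\<close> gives a constant times \<open>(N r)^k\<close>
  with \<open>r = N^(-\<delta>)\<close>, and \<open>N r < 1\<close> because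
  \<open>\<delta> > 1\<close>.\<close>

lemma no_percolation:
  assumes "\<delta> > 1" and B: "\<And>k. k \<ge> 1 \<Longrightarrow> c k \<le> B"
  shows "prob (perc_event N \<delta> c) = 0"
proof -
  define r where "r = real N powr - \<delta>"
  have "r < real N powr - 1"
    unfolding r_def using assms(1) N2 by (intro powr_less_mono) auto
  then have r: "0 < r" "real N * r < 1" using N2 by (auto simp: r_def powr_minus_divide field_simps)
  moreover have "r \<le> real N * r" using N2 r(1) by simp
  ultimately have r1: "r < 1" by linarith
  define A where "A k j = (\<Union>u\<in>hball N k zero_seq. \<Union>y\<in>{y \<in> hball N j zero_seq. u \<noteq> y \<and> hdist u y = j}.
    {\<omega> \<in> space P. \<omega> {u, y}})" for k j
  have A: "A k j \<in> sets P" "prob (A k j) \<le> real N ^ k * B * r ^ j" if "j \<ge> 1" for k j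
    using prob_long_edge_le[OF B that, of k] by (auto simp: A_def r_def)
  have bound: "prob (perc_event N \<delta> c) \<le> B * r / (1 - r) * (real N * r) ^ k" for k
  proof -
    have sums: "(\<lambda>i. real N ^ k * B * r ^ (k + 1) * r ^ i) sums (real N ^ k * B * r ^ (k + 1) * (1 / (1 - r)))"
      using r r1 by (intro sums_mult geometric_sums) auto
    have le: "prob (A k (k + 1 + i)) \<le> real N ^ k * B * r ^ (k + 1) * r ^ i" for i
      using A(2)[of "k + 1 + i" k] by (simp add: power_add mult_ac)
    have "perc_event N \<delta> c \<subseteq> (\<Union>i. A k (k + 1 + i))"
    proof
      fix \<omega> assume \<omega>: "\<omega> \<in> perc_event N \<delta> c"
      then have "infinite (cluster N \<omega> zero_seq)" by (simp add: perc_event_def)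
      then obtain y where "y \<notin> hball N k zero_seq" "y \<in> cluster N \<omega> zero_seq"
        unfolding infinite_cluster_iff[OF zero_Omega] by blast
      from cluster_exit[OF hball_self[OF zero_Omega] this(2,1)]
      obtain u z where uz: "u \<in> hball N k zero_seq" "z \<in> Omega N" "z \<notin> hball N k zero_seq" "adj N \<omega> u z"
        by blast
      have u: "u \<in> Omega N" "u \<noteq> z" using uz hball_subset_Omega by auto
      let ?j = "hdist u z"
      have zj: "z \<in> hball N ?j u" by (rule in_hball_hdist[OF u(1) uz(2) u(2)])
      \<comment> \<open>By the ultrametric property an edge leaving the \<open>k\<close>-ball is
        longer than \<open>k\<close>, and the ball around 0 of radius its length contains both
        endpoints.\<close>
      have kj: "k < ?j"
      proof (rule ccontr)
        assume "\<not> k < ?j"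
        then have "z \<in> hball N k u" using zj hball_mono[of ?j k N u] by auto
        then show False using uz(3) hball_cong[OF uz(1)] by simp
      qed
      then have "u \<in> hball N ?j zero_seq" using uz(1) hball_mono[of k ?j N zero_seq] by auto
      then have "z \<in> hball N ?j zero_seq" using zj hball_cong by blast
      then have "\<omega> \<in> A k ?j" using uz u \<omega> by (auto simp: A_def adj_def perc_event_def G_eq)
      moreover have "?j = k + 1 + (?j - k - 1)" using kj by simp
      ultimately show "\<omega> \<in> (\<Union>i. A k (k + 1 + i))" by (metis UNIV_I UN_I)
    qed
    then have "prob (perc_event N \<delta> c) \<le> prob (\<Union>i. A k (k + 1 + i))"
      using A(1) by (intro finite_measure_mono) auto
    also have "\<dots> \<le> (\<Sum>i. prob (A k (k + 1 + i)))"
      using A(1) le sums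
      by (intro finite_measure_subadditive_countably summable_comparison_test'[OF sums_summable[OF sums]]) auto
    also have "\<dots> \<le> (\<Sum>i. real N ^ k * B * r ^ (k + 1) * r ^ i)"
      using le by (intro suminf_le sums_summable[OF sums] summable_comparison_test'[OF sums_summable[OF sums]]) auto
    also have "\<dots> = B * r / (1 - r) * (real N * r) ^ k"
      using sums_unique[OF sums, symmetric] by (simp add: power_mult_distrib mult_ac)
    finally show ?thesis .
  qed
  have "(\<lambda>k. B * r / (1 - r) * (real N * r) ^ k) \<longlonglongrightarrow> B * r / (1 - r) * 0"
    using r by (intro tendsto_mult tendsto_const LIMSEQ_power_zero) auto
  then have "prob (perc_event N \<delta> c) \<le> 0"
    using bound by (intro LIMSEQ_le_const[of _ 0]) auto
  then show ?thesis by (simp add: measure_le_0_iff)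
qed

end

section \<open>Renormalization\<close>

text \<open>Tests \<open>\<omega>\<close> on the pair without asking that it be an edge; for chosen
  clusters of distinct subballs \<open>C_R_edge\<close> supplies this.\<close>

definition linked :: "(edge \<Rightarrow> bool) \<Rightarrow> vertex set \<Rightarrow> vertex set \<Rightarrow> bool" where
  "linked \<omega> A B \<longleftrightarrow> (\<exists>a\<in>A. \<exists>b\<in>B. \<omega> {a, b})"

lemma cluster_cong_edges:
  "(\<And>e. e \<in> edges N \<Longrightarrow> \<omega> e = \<omega>' e) \<Longrightarrow> cluster N \<omega> x = cluster N \<omega>' x"
proof -
  assume "\<And>e. e \<in> edges N \<Longrightarrow> \<omega> e = \<omega>' e"
  then have "adj N \<omega> = adj N \<omega>'" by (auto simp: adj_def fun_eq_iff)
  then show ?thesis by (simp add: cluster_def)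
qed

locale renormalization = hierarchical +
  fixes m :: nat and c0 :: real
  assumes \<delta>_gt: "\<delta> > -1" and M3: "N ^ m \<ge> 3" and c0_pos: "c0 > 0"
    and c_ge: "\<And>k. k \<ge> 1 \<Longrightarrow> c k \<ge> c0"
begin

abbreviation "M \<equiv> N ^ m"

definition B :: "nat \<Rightarrow> vertex \<Rightarrow> vertex set" where
  "B j x = hball N (j * m) x"

text \<open>One representative, with vanishing low coordinates, of each level \<open>j\<close> subball of \<open>B (j + 1) x\<close>.\<close>

definition R :: "nat \<Rightarrow> vertex \<Rightarrow> vertex set" where
  "R j x = block N (j * m) (Suc j * m) x"

definition rep :: "nat \<Rightarrow> vertex \<Rightarrow> vertex" where
  "rep j x = (\<lambda>i. if i \<le> j * m then 0 else x i)"

definition inner_edges :: "nat \<Rightarrow> vertex \<Rightarrow> edge set" where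
  "inner_edges j x = {e \<in> edges N. e \<subseteq> B j x}"

text \<open>The chosen cluster of a ball at level \<open>j\<close>; the empty set means that the ball is bad. A ball
  at level \<open>j + 1\<close> is good iff at most one of its subballs is bad and the chosen clusters of the good
  ones are pairwise linked. Keeping the choice explicit makes it a function of the edges inside the
  ball, and makes the chosen clusters nested as soon as all subballs are good.\<close>

fun C :: "nat \<Rightarrow> vertex \<Rightarrow> (edge \<Rightarrow> bool) \<Rightarrow> vertex set" where
  "C 0 x \<omega> = {x}"
| "C (Suc j) x \<omega> =
    (if \<forall>r\<in>R j x. \<forall>s\<in>R j x. r \<noteq> s \<longrightarrow>
          linked \<omega> (C j r \<omega>) (C j s \<omega>) \<or> (C j r \<omega> = {}) \<noteq> (C j s \<omega> = {})
     then (\<Union>r\<in>R j x. C j r \<omega>) else {})"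

declare C.simps(2) [simp del]

text \<open>Linking forces both clusters to be nonempty and there are at least 3 subballs, so for
  \<open>x\<close> in \<open>Omega N\<close> all subballs are good, without the exception that
  \<open>C\<close> tolerates.\<close>

definition full :: "nat \<Rightarrow> vertex \<Rightarrow> (edge \<Rightarrow> bool) \<Rightarrow> bool" where
  "full j x \<omega> \<longleftrightarrow> (\<forall>r\<in>R j x. \<forall>s\<in>R j x. r \<noteq> s \<longrightarrow> linked \<omega> (C j r \<omega>) (C j s \<omega>))"

section \<open>Geometry of the blocks\<close>

lemma m_pos: "m \<ge> 1"
  using M3 by (cases m) auto

lemma R_Omega: "r \<in> R j x \<Longrightarrow> r \<in> Omega N"
  by (simp add: R_def block_def hball_def)

lemma B_Omega: "B j x \<subseteq> Omega N"
  by (simp add: B_def hball_subset_Omega)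

lemma B_self: "x \<in> Omega N \<Longrightarrow> x \<in> B j x"
  by (simp add: B_def hball_self)

lemma B_mono: "i \<le> j \<Longrightarrow> B i x \<subseteq> B j x"
  by (simp add: B_def hball_mono)

lemma B_cong: "y \<in> B j x \<Longrightarrow> B j y = B j x"
  by (simp add: B_def hball_cong)

lemma finite_B: "x \<in> Omega N \<Longrightarrow> finite (B j x)"
  by (simp add: B_def card_hball)

lemma card_R: "x \<in> Omega N \<Longrightarrow> finite (R j x)" "x \<in> Omega N \<Longrightarrow> card (R j x) = M"
  using card_block[of x N "j * m" "Suc j * m"] by (auto simp: R_def)

lemma R_cong: "y \<in> B (Suc j) x \<Longrightarrow> R j y = R j x"
  using hball_cong[of y N "Suc j * m" x] by (simp add: R_def block_def B_def)

lemma R_subset: "r \<in> R j x \<Longrightarrow> B j r \<subseteq> B (Suc j) x"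
  by (auto simp: R_def block_def B_def hball_def)

lemma R_disjoint:
  assumes "r \<in> R j x" "s \<in> R j x" "r \<noteq> s"
  shows "B j r \<inter> B j s = {}"
proof (rule ccontr)
  assume "B j r \<inter> B j s \<noteq> {}"
  then obtain z where z: "z \<in> B j r" "z \<in> B j s" by blast
  have "r i = s i" for i
    using z assms(1,2) by (cases "i \<le> j * m") (auto simp: B_def R_def block_def hball_def)
  with assms(3) show False by auto
qed

lemma rep_props:
  assumes "x \<in> Omega N"
  shows rep_in_R: "rep j x \<in> R j x" and in_B_rep: "x \<in> B j (rep j x)"
proof -
  have "finite {i. x i \<noteq> 0}" using assms by (simp add: Omega_def)
  then have "finite {i. rep j x i \<noteq> 0}"
    by (rule rev_finite_subset) (auto simp: rep_def)
  then have "rep j x \<in> Omega N"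
    using assms N2 by (auto simp: Omega_def rep_def)
  then show "rep j x \<in> R j x" "x \<in> B j (rep j x)"
    using assms by (auto simp: R_def block_def B_def hball_def rep_def)
qed

lemma finite_inner_edges: "x \<in> Omega N \<Longrightarrow> finite (inner_edges j x)"
  using finite_B[of x j] by (auto simp: inner_edges_def intro: finite_subset[of _ "Pow (B j x)"])

lemma inner_edges_sub: "inner_edges j x \<subseteq> edges N"
  by (auto simp: inner_edges_def)

lemma inner_edges_R: "r \<in> R j x \<Longrightarrow> inner_edges j r \<subseteq> inner_edges (Suc j) x"
  using R_subset[of r j x] by (auto simp: inner_edges_def)

section \<open>Locality, connectedness and size of the chosen clusters\<close>

lemma C_subset: "x \<in> Omega N \<Longrightarrow> C j x \<omega> \<subseteq> B j x"
proof (induction j arbitrary: x)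
  case 0
  then show ?case by (simp add: B_self)
next
  case (Suc j)
  have "C j r \<omega> \<subseteq> B (Suc j) x" if "r \<in> R j x" for r
    using Suc.IH[OF R_Omega[OF that]] R_subset[OF that] by blast
  then show ?case by (auto simp: C.simps(2))
qed

text \<open>The two subballs are disjoint, so the endpoints are distinct and form a genuine edge of
  the larger ball.\<close>

lemma C_R_edge:
  assumes "r \<in> R j x" "s \<in> R j x" "r \<noteq> s" "a \<in> C j r \<omega>" "b \<in> C j s \<omega>'"
  shows "{a, b} \<in> inner_edges (Suc j) x"
proof -
  have "a \<in> B j r" "b \<in> B j s"
    using assms C_subset[OF R_Omega] by blast+
  then show ?thesis
    using R_disjoint[OF assms(1-3)] R_subset[OF assms(1)] R_subset[OF assms(2)] B_Omega[of j r] B_Omega[of j s]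
    by (auto simp: inner_edges_def in_edges_iff)
qed

text \<open>The chosen cluster belongs to the ball and not to its centre, because \<open>R\<close>
  only sees the ball.\<close>

lemma C_cong:
  assumes "x \<in> Omega N" "y \<in> B j x"
  shows "C j y \<omega> = C j x \<omega>"
proof (cases j)
  case 0
  then show ?thesis using assms by (simp add: B_def hball_0)
next
  case (Suc i)
  have "R i y = R i x" using R_cong assms Suc by blast
  then show ?thesis by (simp only: Suc C.simps)
qed

lemma linked_C_cong:
  assumes "\<And>e. e \<in> inner_edges (Suc j) x \<Longrightarrow> \<omega> e = \<omega>' e"
    and "r \<in> R j x" "s \<in> R j x" "r \<noteq> s" "C j r \<omega> = C j r \<omega>'" "C j s \<omega> = C j s \<omega>'"
  shows "linked \<omega> (C j r \<omega>) (C j s \<omega>) = linked \<omega>' (C j r \<omega>') (C j s \<omega>')"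
proof -
  have "\<omega> {a, b} = \<omega>' {a, b}" if "a \<in> C j r \<omega>'" "b \<in> C j s \<omega>'" for a b
    using C_R_edge[OF assms(2-4) that] assms(1) by blast
  then show ?thesis unfolding linked_def assms(5,6) by blast
qed

text \<open>Inductively the clusters of the subballs are local, and their links are edges of the
  larger ball. This locality is the source of all independence used below.\<close>

lemma C_depends: "x \<in> Omega N \<Longrightarrow> depends_on (inner_edges j x) (C j x)"
proof (induction j arbitrary: x)
  case 0
  then show ?case by (simp add: depends_on_def)
next
  case (Suc j)
  show ?case
  proof (rule depends_onI)
    fix \<omega> \<omega>' :: "edge \<Rightarrow> bool" assume eq: "\<And>e. e \<in> inner_edges (Suc j) x \<Longrightarrow> \<omega> e = \<omega>' e"
    have C: "C j r \<omega> = C j r \<omega>'" if "r \<in> R j x" for r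
      using depends_onD[OF Suc.IH[OF R_Omega[OF that]]] inner_edges_R[OF that] eq by blast
    have lk: "linked \<omega> (C j r \<omega>') (C j s \<omega>') = linked \<omega>' (C j r \<omega>') (C j s \<omega>')"
      if "r \<in> R j x" "s \<in> R j x" "r \<noteq> s" for r s
      using linked_C_cong[OF eq that C[OF that(1)] C[OF that(2)]] C that by simp
    have "(\<forall>r\<in>R j x. \<forall>s\<in>R j x. r \<noteq> s \<longrightarrow>
        linked \<omega> (C j r \<omega>) (C j s \<omega>) \<or> (C j r \<omega> = {}) \<noteq> (C j s \<omega> = {})) \<longleftrightarrow>
      (\<forall>r\<in>R j x. \<forall>s\<in>R j x. r \<noteq> s \<longrightarrow>
        linked \<omega>' (C j r \<omega>') (C j s \<omega>') \<or> (C j r \<omega>' = {}) \<noteq> (C j s \<omega>' = {}))"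
      by (intro ball_cong refl imp_cong) (simp_all add: lk C)
    moreover have "(\<Union>r\<in>R j x. C j r \<omega>) = (\<Union>r\<in>R j x. C j r \<omega>')"
      using C by auto
    ultimately show "C (Suc j) x \<omega> = C (Suc j) x \<omega>'"
      by (simp only: C.simps)
  qed
qed

lemma full_depends: "x \<in> Omega N \<Longrightarrow> depends_on (inner_edges (Suc j) x) (full j x)"
proof (rule depends_onI)
  fix \<omega> \<omega>' :: "edge \<Rightarrow> bool"
  assume eq: "\<And>e. e \<in> inner_edges (Suc j) x \<Longrightarrow> \<omega> e = \<omega>' e"
  have C: "C j r \<omega> = C j r \<omega>'" if "r \<in> R j x" for r
    using depends_onD[OF C_depends[OF R_Omega[OF that]]] inner_edges_R[OF that] eq by blast
  show "full j x \<omega> = full j x \<omega>'"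
    unfolding full_def by (intro ball_cong refl imp_cong linked_C_cong[OF eq] C)
qed

lemma pred_C: "x \<in> Omega N \<Longrightarrow> Measurable.pred P (\<lambda>\<omega>. Q (C j x \<omega>))"
proof (rule pred_finite[OF finite_inner_edges inner_edges_sub, of x j])
  assume x: "x \<in> Omega N"
  show "depends_on (inner_edges j x) (\<lambda>\<omega>. Q (C j x \<omega>))"
    by (rule depends_onI) (rule arg_cong[where f=Q, OF depends_onD[OF C_depends[OF x]]])
qed

lemma pred_full [measurable]: "x \<in> Omega N \<Longrightarrow> Measurable.pred P (full j x)"
  by (rule pred_finite[OF finite_inner_edges inner_edges_sub full_depends])

lemma C_connected:
  "x \<in> Omega N \<Longrightarrow> a \<in> C j x \<omega> \<Longrightarrow> b \<in> C j x \<omega> \<Longrightarrow> b \<in> cluster N \<omega> a"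
proof (induction j arbitrary: x a b)
  case 0
  then show ?case by (simp add: cluster_self)
next
  case (Suc j)
  from Suc.prems obtain r s where rs: "r \<in> R j x" "a \<in> C j r \<omega>" "s \<in> R j x" "b \<in> C j s \<omega>"
    by (auto simp: C.simps(2) split: if_splits)
  show ?case
  proof (cases "r = s")
    case True
    then show ?thesis using Suc.IH[OF R_Omega] rs by blast
  next
    case False
    \<comment> \<open>Both clusters are nonempty, so the other alternative in the definition of
      \<open>C\<close> is excluded.\<close>
    then have "linked \<omega> (C j r \<omega>) (C j s \<omega>)"
      using Suc.prems rs by (force simp: C.simps(2) split: if_splits)
    then obtain a' b' where ab: "a' \<in> C j r \<omega>" "b' \<in> C j s \<omega>" "\<omega> {a', b'}"
      by (auto simp: linked_def)
    then have "adj N \<omega> a' b'"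
      using C_R_edge[OF rs(1,3) False ab(1,2)] by (simp add: adj_def inner_edges_def)
    then have "b' \<in> cluster N \<omega> a'" by (rule adj_in_cluster)
    moreover have "a' \<in> cluster N \<omega> a" "b \<in> cluster N \<omega> b'"
      using Suc.IH[OF R_Omega] rs ab by blast+
    ultimately show ?thesis using cluster_trans by blast
  qed
qed

text \<open>At least \<open>M - 1\<close> subballs are good, and their chosen clusters are
  disjoint.\<close>

lemma C_card: "x \<in> Omega N \<Longrightarrow> C j x \<omega> \<noteq> {} \<Longrightarrow> card (C j x \<omega>) \<ge> (M - 1) ^ j"
proof (induction j arbitrary: x)
  case 0
  then show ?case by simp
next
  case (Suc j)
  define R' where "R' = {r \<in> R j x. C j r \<omega> \<noteq> {}}"
  have cond: "\<forall>r\<in>R j x. \<forall>s\<in>R j x. r \<noteq> s \<longrightarrow>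
      linked \<omega> (C j r \<omega>) (C j s \<omega>) \<or> (C j r \<omega> = {}) \<noteq> (C j s \<omega> = {})"
    and C: "C (Suc j) x \<omega> = (\<Union>r\<in>R j x. C j r \<omega>)"
    using Suc.prems(2) by (auto simp: C.simps(2) split: if_splits)
  note fin = card_R[OF Suc.prems(1), of j]
  have "finite R'" using fin by (simp add: R'_def)
  \<comment> \<open>Two bad subballs would have to be linked, which empty sets never are.\<close>
  have "r = s" if "r \<in> R j x - R'" "s \<in> R j x - R'" for r s
    using that cond by (auto simp: R'_def linked_def)
  then have "card (R j x - R') \<le> 1"
    using fin by (simp add: card_le_Suc0_iff_eq)
  then have cR': "card R' \<ge> M - 1"
    using fin card_Diff_subset[of R' "R j x"] \<open>finite R'\<close> by (auto simp: R'_def)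
  have sub: "C j r \<omega> \<subseteq> B j r" "finite (B j r)" if "r \<in> R j x" for r
    using C_subset[OF R_Omega[OF that]] finite_B[OF R_Omega[OF that]] by auto
  have "C (Suc j) x \<omega> = (\<Union>r\<in>R'. C j r \<omega>)" by (auto simp: C R'_def)
  also have "card \<dots> = (\<Sum>r\<in>R'. card (C j r \<omega>))"
  proof (rule card_UN_disjoint[OF \<open>finite R'\<close>])
    show "\<forall>r\<in>R'. finite (C j r \<omega>)" using finite_subset[OF sub] by (auto simp: R'_def)
    show "\<forall>r\<in>R'. \<forall>s\<in>R'. r \<noteq> s \<longrightarrow> C j r \<omega> \<inter> C j s \<omega> = {}"
    proof (intro ballI impI)
      fix r s assume "r \<in> R'" "s \<in> R'" "r \<noteq> s"
      then show "C j r \<omega> \<inter> C j s \<omega> = {}"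
        using sub(1)[of r] sub(1)[of s] R_disjoint[of r j x s] by (auto simp: R'_def)
    qed
  qed
  finally have 1: "card (C (Suc j) x \<omega>) = \<dots>" .
  have "(M - 1) ^ Suc j \<le> (\<Sum>r\<in>R'. (M - 1) ^ j)"
    using cR' by simp
  also have "\<dots> \<le> (\<Sum>r\<in>R'. card (C j r \<omega>))"
    using Suc.IH R_Omega by (intro sum_mono) (auto simp: R'_def)
  finally show ?case by (simp only: 1)
qed

lemma full_subset:
  assumes "full j x \<omega>" "r \<in> R j x"
  shows "C j r \<omega> \<subseteq> C (Suc j) x \<omega>"
  using assms by (auto simp: full_def C.simps(2))

lemma full_subset':
  assumes "x \<in> Omega N" "y \<in> B (Suc j) x" "full j x \<omega>"
  shows "C j y \<omega> \<subseteq> C (Suc j) x \<omega>"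
proof -
  have y: "y \<in> Omega N" using assms(2) B_Omega by blast
  have r: "rep j y \<in> R j x" using rep_in_R[OF y, of j] R_cong[OF assms(2)] by simp
  have "C j y \<omega> = C j (rep j y) \<omega>"
    by (rule C_cong[OF R_Omega[OF r] in_B_rep[OF y]])
  then show ?thesis using full_subset[OF assms(3) r] by simp
qed

text \<open>Starting from \<open>C 0 x = {x}\<close>, fullness at each level passes the chosen
  cluster on into the next one.\<close>

lemma full_chain:
  assumes "x \<in> Omega N" "\<And>i. i < l \<Longrightarrow> full i x \<omega>"
  shows "x \<in> C l x \<omega>"
  using assms(2)
proof (induction l)
  case (Suc l)
  then have "x \<in> C l x \<omega>" by simp
  then show ?case using full_subset'[OF assms(1) B_self[OF assms(1)], of l \<omega>] Suc by blast
qed simp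

section \<open>Probability that a link fails or a ball is bad\<close>

definition eps :: "nat \<Rightarrow> real" where
  "eps j = exp (- (c0 * real (M - 1) ^ (2 * j) / real N powr (real (Suc j * m) * (1 + \<delta>))))"

lemma eps_pos: "eps j > 0"
  by (simp add: eps_def)

text \<open>The origin of \<open>eps\<close>: there are at least \<open>(M - 1)^(2 j)\<close> pairs,
  each at distance at most \<open>(j + 1) m\<close> and hence open with probability at least
  \<open>min q 1\<close>; and \<open>1 - min q 1 \<le> exp (- q)\<close>.\<close>

lemma prob_closed_between:
  assumes x: "x \<in> Omega N" and rs: "r \<in> R j x" "s \<in> R j x" "r \<noteq> s"
    and A: "A \<subseteq> B j r" "card A \<ge> (M - 1) ^ j" and A': "A' \<subseteq> B j s" "card A' \<ge> (M - 1) ^ j"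
  shows "prob {\<omega> \<in> space P. \<forall>e\<in>(\<lambda>(a, b). {a, b}) ` (A \<times> A'). \<not> \<omega> e} \<le> eps j"
proof -
  let ?X = "(\<lambda>(a, b). {a, b}) ` (A \<times> A')"
  define q where "q = c0 / real N powr (real (Suc j * m) * (1 + \<delta>))"
  have q0: "q \<ge> 0" using c0_pos by (simp add: q_def)
  have fin: "finite A" "finite A'"
    using A A' finite_B[OF R_Omega] rs finite_subset by metis+
  \<comment> \<open>As the subballs are disjoint, no unordered pair is counted twice.\<close>
  have "inj_on (\<lambda>(a, b). {a, b}) (A \<times> A')"
    using A(1) A'(1) R_disjoint[OF rs] by (auto simp: inj_on_def doubleton_eq_iff)
  then have cX: "card ?X = card A * card A'"
    by (simp add: card_image card_cartesian_product)
  have e: "{a, b} \<in> edges N \<and> 0 \<le> edge_set_prob N \<delta> c {a, b} \<and> edge_set_prob N \<delta> c {a, b} \<le> 1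
      \<and> 1 - edge_set_prob N \<delta> c {a, b} \<le> exp (- q)" if "a \<in> A" "b \<in> A'" for a b
  proof -
    have ab: "a \<in> Omega N" "b \<in> Omega N" "a \<noteq> b" and abB: "a \<in> B (Suc j) x" "b \<in> B (Suc j) x"
      using that A(1) A'(1) B_Omega R_disjoint[OF rs] R_subset[OF rs(1)] R_subset[OF rs(2)] by blast+
    let ?k = "hdist a b"
    have "b \<in> hball N (Suc j * m) a"
      using abB B_cong[of a "Suc j" x] by (simp add: B_def)
    then have k: "?k \<le> Suc j * m" by (rule hdist_le[OF ab])
    have k1: "?k \<ge> 1" by (rule hdist_ge_1[OF ab])
    have "q \<le> c0 / real N powr (real ?k * (1 + \<delta>))"
      unfolding q_def using k c0_pos \<delta>_gt N2
      by (intro divide_left_mono powr_mono mult_right_mono mult_pos_pos) (auto simp flip: of_nat_mult)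
    also have "\<dots> \<le> c ?k / real N powr (real ?k * (1 + \<delta>))"
      using c_ge[OF k1] by (intro divide_right_mono) auto
    finally have "min q 1 \<le> edge_set_prob N \<delta> c {a, b}"
      by (auto simp: edge_set_prob_eq[OF ab(3)] edge_prob_def Let_def)
    then have "1 - edge_set_prob N \<delta> c {a, b} \<le> max (1 - q) 0" by auto
    also have "\<dots> \<le> exp (- q)" using exp_ge_add_one_self[of "- q"] by simp
    finally show ?thesis using ab edge_prob_bounds[OF ab] by (simp add: in_edges_iff)
  qed
  have "prob {\<omega> \<in> space P. \<forall>e\<in>?X. \<not> \<omega> e} = (\<Prod>e\<in>?X. 1 - edge_set_prob N \<delta> c e)"
    using fin e by (intro prob_all_closed) auto
  also have "\<dots> \<le> (\<Prod>e\<in>?X. exp (- q))"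
    using e by (intro prod_mono) auto
  also have "\<dots> = exp (- (real (card A * card A') * q))"
    by (simp add: cX exp_of_nat_mult[symmetric])
  also have "\<dots> \<le> exp (- (real (M - 1) ^ (2 * j) * q))"
  proof -
    have "(M - 1) ^ (2 * j) \<le> card A * card A'"
      using mult_le_mono[OF A(2) A'(2)] by (simp add: mult_2 power_add)
    then have "real (M - 1) ^ (2 * j) \<le> real (card A * card A')"
      by (simp only: of_nat_le_iff flip: of_nat_power)
    then show ?thesis using q0 by (simp add: mult_right_mono)
  qed
  finally show ?thesis by (simp add: eps_def q_def mult_ac)
qed

text \<open>Split according to the values of the two chosen clusters. Given these, the connecting
  edges are still fresh, as they lie in neither subball, so \<open>prob_closed_between\<close>
  applies to each value.\<close>

lemma prob_unlinked:
  assumes x: "x \<in> Omega N" and rs: "r \<in> R j x" "s \<in> R j x" "r \<noteq> s"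
  shows "prob {\<omega> \<in> space P. C j r \<omega> \<noteq> {} \<and> C j s \<omega> \<noteq> {} \<and> \<not> linked \<omega> (C j r \<omega>) (C j s \<omega>)} \<le> eps j"
proof -
  have O: "r \<in> Omega N" "s \<in> Omega N" using rs R_Omega by auto
  \<comment> \<open>A finite set that contains all possible nonempty values of the chosen
    cluster.\<close>
  define K where "K r = {A. A \<subseteq> B j r \<and> card A \<ge> (M - 1) ^ j}" for r
  have finK: "finite (K r \<times> K s)" using finite_B[OF O(1)] finite_B[OF O(2)] by (auto simp: K_def)
  let ?X = "\<lambda>A A'. (\<lambda>(a, b). {a, b}) ` (A \<times> A') :: edge set"
  let ?D = "\<lambda>z. {\<omega> \<in> space P. C j r \<omega> = fst z \<and> C j s \<omega> = snd z}"
  let ?F = "\<lambda>z. {\<omega> \<in> space P. (C j r \<omega> = fst z \<and> C j s \<omega> = snd z) \<and> (\<forall>e\<in>?X (fst z) (snd z). \<not> \<omega> e)}"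
  note [measurable] = pred_C[OF O(1)] pred_C[OF O(2)]
  have D: "?D z \<in> sets P" for z by measurable
  have X: "?X A A' \<subseteq> edges N" "finite (?X A A')" "(inner_edges j r \<union> inner_edges j s) \<inter> ?X A A' = {}"
    if "A \<in> K r" "A' \<in> K s" for A A'
  proof -
    have AA: "A \<subseteq> B j r" "A' \<subseteq> B j s" using that by (auto simp: K_def)
    then show "?X A A' \<subseteq> edges N"
      using R_disjoint[OF rs] B_Omega by (fastforce simp: in_edges_iff)
    show "finite (?X A A')" using AA finite_B[OF O(1)] finite_B[OF O(2)] finite_subset by blast
    show "(inner_edges j r \<union> inner_edges j s) \<inter> ?X A A' = {}"
      using AA R_disjoint[OF rs] by (fastforce simp: inner_edges_def)
  qed
  have F: "?F z \<in> sets P \<and> prob (?F z) \<le> prob (?D z) * eps j" if zK: "z \<in> K r \<times> K s" for z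
  proof -
    obtain A A' where z: "z = (A, A')" "A \<in> K r" "A' \<in> K s" using zK by blast
    have dX: "depends_on (?X A A') (\<lambda>\<omega>. \<forall>e\<in>?X A A'. \<not> \<omega> e)" by (auto simp: depends_on_def)
    have pX[measurable]: "Measurable.pred P (\<lambda>\<omega>. \<forall>e\<in>?X A A'. \<not> \<omega> e)"
      by (rule pred_finite[OF X(2,1)[OF z(2,3)] dX])
    have dC: "depends_on (inner_edges j r \<union> inner_edges j s) (\<lambda>\<omega>. C j r \<omega> = A \<and> C j s \<omega> = A')"
    proof (rule depends_onI)
      fix \<omega> \<omega>' :: "edge \<Rightarrow> bool"
      assume eq: "\<And>e. e \<in> inner_edges j r \<union> inner_edges j s \<Longrightarrow> \<omega> e = \<omega>' e"
      have "C j r \<omega> = C j r \<omega>'" "C j s \<omega> = C j s \<omega>'"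
        by (rule depends_onD[OF C_depends[OF O(1)]] depends_onD[OF C_depends[OF O(2)]]; simp add: eq)+
      then show "(C j r \<omega> = A \<and> C j s \<omega> = A') = (C j r \<omega>' = A \<and> C j s \<omega>' = A')" by simp
    qed
    have pC[measurable]: "Measurable.pred P (\<lambda>\<omega>. C j r \<omega> = A \<and> C j s \<omega> = A')" by measurable
    have "prob (?F z) = prob (?D z) * prob {\<omega> \<in> space P. \<forall>e\<in>?X A A'. \<not> \<omega> e}"
      using prob_indep[OF X(3)[OF z(2,3)] _ X(1)[OF z(2,3)] dC dX pC pX] inner_edges_sub z(1) by simp
    also have "\<dots> \<le> prob (?D z) * eps j"
      using z(2,3) by (intro mult_left_mono prob_closed_between[OF x rs]) (auto simp: K_def)
    finally have "prob (?F z) \<le> prob (?D z) * eps j" .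
    moreover have "?F z \<in> sets P" unfolding z(1) fst_conv snd_conv by measurable
    ultimately show ?thesis by blast
  qed
  have "{\<omega> \<in> space P. C j r \<omega> \<noteq> {} \<and> C j s \<omega> \<noteq> {} \<and> \<not> linked \<omega> (C j r \<omega>) (C j s \<omega>)}
      \<subseteq> (\<Union>z\<in>K r \<times> K s. ?F z)"
  proof
    fix \<omega> assume \<omega>: "\<omega> \<in> {\<omega> \<in> space P. C j r \<omega> \<noteq> {} \<and> C j s \<omega> \<noteq> {} \<and> \<not> linked \<omega> (C j r \<omega>) (C j s \<omega>)}"
    then have "(C j r \<omega>, C j s \<omega>) \<in> K r \<times> K s"
      using C_card C_subset O by (auto simp: K_def)
    moreover have "\<omega> \<in> ?F (C j r \<omega>, C j s \<omega>)"
      using \<omega> by (auto simp: linked_def)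
    ultimately show "\<omega> \<in> (\<Union>z\<in>K r \<times> K s. ?F z)" by blast
  qed
  then have "prob {\<omega> \<in> space P. C j r \<omega> \<noteq> {} \<and> C j s \<omega> \<noteq> {} \<and> \<not> linked \<omega> (C j r \<omega>) (C j s \<omega>)}
      \<le> prob (\<Union>z\<in>K r \<times> K s. ?F z)"
    using F finK by (intro finite_measure_mono sets.finite_UN) auto
  also have "\<dots> \<le> (\<Sum>z\<in>K r \<times> K s. prob (?F z))"
    using F finK by (intro measure_UNION_le) auto
  also have "\<dots> \<le> (\<Sum>z\<in>K r \<times> K s. prob (?D z) * eps j)"
    using F by (intro sum_mono) auto
  also have "\<dots> = (\<Sum>z\<in>K r \<times> K s. prob (?D z)) * eps j"
    by (simp add: sum_distrib_right)
  also have "(\<Sum>z\<in>K r \<times> K s. prob (?D z)) = prob (\<Union>z\<in>K r \<times> K s. ?D z)"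
    using D finK by (intro finite_measure_finite_Union[symmetric]) (auto simp: disjoint_family_on_def prod_eq_iff)
  also have "\<dots> * eps j \<le> 1 * eps j"
    using eps_pos[of j] by (intro mult_right_mono) auto
  finally show ?thesis by simp
qed

text \<open>Disjoint subballs share no edge. This independence produces the square in the recursion
  for bad balls.\<close>

lemma prob_both_empty:
  assumes x: "x \<in> Omega N" and rs: "r \<in> R j x" "s \<in> R j x" "r \<noteq> s"
  shows "prob {\<omega> \<in> space P. C j r \<omega> = {} \<and> C j s \<omega> = {}} =
    prob {\<omega> \<in> space P. C j r \<omega> = {}} * prob {\<omega> \<in> space P. C j s \<omega> = {}}"
proof (rule prob_indep)
  have O: "r \<in> Omega N" "s \<in> Omega N" using rs R_Omega by auto
  show "inner_edges j r \<inter> inner_edges j s = {}"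
  proof (rule ccontr)
    assume "inner_edges j r \<inter> inner_edges j s \<noteq> {}"
    then obtain e where e: "e \<in> edges N" "e \<subseteq> B j r" "e \<subseteq> B j s" by (auto simp: inner_edges_def)
    then have "e \<noteq> {}" by (auto simp: edges_def)
    then show False using e R_disjoint[OF rs] by blast
  qed
  show "depends_on (inner_edges j r) (\<lambda>\<omega>. C j r \<omega> = {})" "depends_on (inner_edges j s) (\<lambda>\<omega>. C j s \<omega> = {})"
    using C_depends O unfolding depends_on_def by metis+
  show "Measurable.pred P (\<lambda>\<omega>. C j r \<omega> = {})" "Measurable.pred P (\<lambda>\<omega>. C j s \<omega> = {})"
    by (rule pred_C[OF O(1)], rule pred_C[OF O(2)])
qed (rule inner_edges_sub)+

lemma sets_pair_events:
  assumes x: "x \<in> Omega N" and rs: "r \<in> R j x" "s \<in> R j x" "r \<noteq> s"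
  shows "{\<omega> \<in> space P. C j r \<omega> = {} \<and> C j s \<omega> = {}} \<in> sets P"
    and "{\<omega> \<in> space P. C j r \<omega> = {}} \<in> sets P"
    and "{\<omega> \<in> space P. C j r \<omega> \<noteq> {} \<and> C j s \<omega> \<noteq> {} \<and> \<not> linked \<omega> (C j r \<omega>) (C j s \<omega>)} \<in> sets P"
proof -
  have O: "r \<in> Omega N" "s \<in> Omega N" using rs R_Omega by auto
  note [measurable] = pred_C[OF O(1)] pred_C[OF O(2)]
  show "{\<omega> \<in> space P. C j r \<omega> = {} \<and> C j s \<omega> = {}} \<in> sets P"
    "{\<omega> \<in> space P. C j r \<omega> = {}} \<in> sets P" by measurable
  have "depends_on (inner_edges (Suc j) x) (\<lambda>\<omega>. linked \<omega> (C j r \<omega>) (C j s \<omega>))"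
  proof (rule depends_onI)
    fix \<omega> \<omega>' :: "edge \<Rightarrow> bool"
    assume eq: "\<And>e. e \<in> inner_edges (Suc j) x \<Longrightarrow> \<omega> e = \<omega>' e"
    have C: "C j r \<omega> = C j r \<omega>'" if "r \<in> R j x" for r
      using depends_onD[OF C_depends[OF R_Omega[OF that]]] inner_edges_R[OF that] eq by blast
    show "linked \<omega> (C j r \<omega>) (C j s \<omega>) = linked \<omega>' (C j r \<omega>') (C j s \<omega>')"
      by (rule linked_C_cong[OF eq rs C[OF rs(1)] C[OF rs(2)]])
  qed
  from pred_finite[OF finite_inner_edges[OF x] inner_edges_sub this]
  have [measurable]: "Measurable.pred P (\<lambda>\<omega>. linked \<omega> (C j r \<omega>) (C j s \<omega>))" .
  show "{\<omega> \<in> space P. C j r \<omega> \<noteq> {} \<and> C j s \<omega> \<noteq> {} \<and> \<not> linked \<omega> (C j r \<omega>) (C j s \<omega>)} \<in> sets P"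
    by measurable
qed

text \<open>Union bound over at most \<open>M^2\<close> ordered pairs of distinct subballs, shared
  by the next two estimates.\<close>

lemma prob_pairs_le:
  assumes x: "x \<in> Omega N" and F: "\<And>r s. r \<in> R j x \<Longrightarrow> s \<in> R j x \<Longrightarrow> r \<noteq> s \<Longrightarrow> F r s \<in> sets P \<and> prob (F r s) \<le> b"
    and sub: "A \<subseteq> (\<Union>z\<in>{z \<in> R j x \<times> R j x. fst z \<noteq> snd z}. F (fst z) (snd z))" and b: "b \<ge> 0"
  shows "prob A \<le> real M ^ 2 * b"
proof -
  let ?Z = "{z \<in> R j x \<times> R j x. fst z \<noteq> snd z}"
  have fin: "finite ?Z" using card_R(1)[OF x] by simp
  have "prob A \<le> prob (\<Union>z\<in>?Z. F (fst z) (snd z))"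
    using F fin by (intro finite_measure_mono[OF sub] sets.finite_UN) auto
  also have "\<dots> \<le> (\<Sum>z\<in>?Z. prob (F (fst z) (snd z)))"
    using F fin by (intro measure_UNION_le) auto
  also have "\<dots> \<le> (\<Sum>z\<in>?Z. b)" using F by (intro sum_mono) auto
  also have "\<dots> \<le> (\<Sum>z\<in>R j x \<times> R j x. b)"
    using card_R(1)[OF x] b by (intro sum_mono2) auto
  also have "\<dots> = real M ^ 2 * b"
    by (simp add: card_cartesian_product card_R(2)[OF x] power2_eq_square)
  finally show ?thesis .
qed

text \<open>A bad ball has two bad subballs or two good ones that are not linked. Tolerating a
  single bad subball is what makes the recursion quadratic in \<open>a\<close>.\<close>

lemma prob_C_empty_Suc:
  assumes a: "\<And>x. x \<in> Omega N \<Longrightarrow> prob {\<omega> \<in> space P. C j x \<omega> = {}} \<le> a" and x: "x \<in> Omega N"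
  shows "prob {\<omega> \<in> space P. C (Suc j) x \<omega> = {}} \<le> real M ^ 2 * (a\<^sup>2 + eps j)"
proof (rule prob_pairs_le[OF x, where j=j and F="\<lambda>r s. {\<omega> \<in> space P. C j r \<omega> = {} \<and> C j s \<omega> = {}} \<union>
    {\<omega> \<in> space P. C j r \<omega> \<noteq> {} \<and> C j s \<omega> \<noteq> {} \<and> \<not> linked \<omega> (C j r \<omega>) (C j s \<omega>)}"])
  fix r s assume rs: "r \<in> R j x" "s \<in> R j x" "r \<noteq> s"
  let ?A = "{\<omega> \<in> space P. C j r \<omega> = {} \<and> C j s \<omega> = {}}"
  let ?B = "{\<omega> \<in> space P. C j r \<omega> \<noteq> {} \<and> C j s \<omega> \<noteq> {} \<and> \<not> linked \<omega> (C j r \<omega>) (C j s \<omega>)}"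
  note sets = sets_pair_events[OF x rs]
  have 1: "prob (?A \<union> ?B) \<le> prob ?A + prob ?B"
    using sets by (intro measure_Un_le)
  have 2: "prob ?A \<le> a * a"
    unfolding prob_both_empty[OF x rs]
    using a[OF R_Omega[OF rs(1)]] a[OF R_Omega[OF rs(2)]]
    by (intro mult_mono) (auto intro: order_trans[OF measure_nonneg])
  have "prob ?B \<le> eps j" by (rule prob_unlinked[OF x rs])
  with 1 2 have "prob (?A \<union> ?B) \<le> a * a + eps j" by linarith
  then show "?A \<union> ?B \<in> sets P \<and> prob (?A \<union> ?B) \<le> a\<^sup>2 + eps j"
    using sets by (simp add: power2_eq_square)
next
  show "{\<omega> \<in> space P. C (Suc j) x \<omega> = {}} \<subseteq> (\<Union>z\<in>{z \<in> R j x \<times> R j x. fst z \<noteq> snd z}.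
      {\<omega> \<in> space P. C j (fst z) \<omega> = {} \<and> C j (snd z) \<omega> = {}} \<union>
      {\<omega> \<in> space P. C j (fst z) \<omega> \<noteq> {} \<and> C j (snd z) \<omega> \<noteq> {} \<and> \<not> linked \<omega> (C j (fst z) \<omega>) (C j (snd z) \<omega>)})"
  proof
    fix \<omega> assume \<omega>: "\<omega> \<in> {\<omega> \<in> space P. C (Suc j) x \<omega> = {}}"
    have "\<exists>r\<in>R j x. \<exists>s\<in>R j x. r \<noteq> s \<and> ((C j r \<omega> = {}) = (C j s \<omega> = {})) \<and> \<not> linked \<omega> (C j r \<omega>) (C j s \<omega>)"
    \<comment> \<open>Otherwise the cluster would be the union over all subballs, hence all of these
      would be bad; but two distinct bad subballs already violate the condition.\<close>
    proof (rule ccontr)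
      assume neg: "\<not> ?thesis"
      then have "C (Suc j) x \<omega> = (\<Union>r\<in>R j x. C j r \<omega>)" by (auto simp: C.simps(2))
      then have e: "C j r \<omega> = {}" if "r \<in> R j x" for r using \<omega> that by auto
      have "\<not> card (R j x) \<le> Suc 0" using card_R(2)[OF x] M3 by simp
      then obtain r s where "r \<in> R j x" "s \<in> R j x" "r \<noteq> s"
        using card_R(1)[OF x] by (auto simp: card_le_Suc0_iff_eq)
      with neg e show False by (auto simp: linked_def)
    qed
    then obtain r s where "r \<in> R j x" "s \<in> R j x" "r \<noteq> s"
      "((C j r \<omega> = {}) = (C j s \<omega> = {}))" "\<not> linked \<omega> (C j r \<omega>) (C j s \<omega>)" by blast
    then show "\<omega> \<in> (\<Union>z\<in>{z \<in> R j x \<times> R j x. fst z \<noteq> snd z}.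
      {\<omega> \<in> space P. C j (fst z) \<omega> = {} \<and> C j (snd z) \<omega> = {}} \<union>
      {\<omega> \<in> space P. C j (fst z) \<omega> \<noteq> {} \<and> C j (snd z) \<omega> \<noteq> {} \<and> \<not> linked \<omega> (C j (fst z) \<omega>) (C j (snd z) \<omega>)})"
      using \<omega> by (intro UN_I[of "(r, s)"]) auto
  qed
next
  show "0 \<le> a\<^sup>2 + eps j" using eps_pos[of j] by (simp add: add_nonneg_nonneg)
qed

text \<open>Here one bad subball already spoils the event, so the bound is linear in
  \<open>a\<close>.\<close>

lemma prob_not_full:
  assumes a: "\<And>x. x \<in> Omega N \<Longrightarrow> prob {\<omega> \<in> space P. C j x \<omega> = {}} \<le> a" and x: "x \<in> Omega N"
  shows "prob {\<omega> \<in> space P. \<not> full j x \<omega>} \<le> real M ^ 2 * (2 * a + eps j)"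
proof (rule prob_pairs_le[OF x, where j=j and F="\<lambda>r s. {\<omega> \<in> space P. C j r \<omega> = {}} \<union> {\<omega> \<in> space P. C j s \<omega> = {}} \<union>
    {\<omega> \<in> space P. C j r \<omega> \<noteq> {} \<and> C j s \<omega> \<noteq> {} \<and> \<not> linked \<omega> (C j r \<omega>) (C j s \<omega>)}"])
  fix r s assume rs: "r \<in> R j x" "s \<in> R j x" "r \<noteq> s"
  let ?A = "{\<omega> \<in> space P. C j r \<omega> = {}}"
  let ?A' = "{\<omega> \<in> space P. C j s \<omega> = {}}"
  let ?B = "{\<omega> \<in> space P. C j r \<omega> \<noteq> {} \<and> C j s \<omega> \<noteq> {} \<and> \<not> linked \<omega> (C j r \<omega>) (C j s \<omega>)}"
  note sets = sets_pair_events(2,3)[OF x rs] sets_pair_events(2)[OF x rs(2,1) rs(3)[symmetric]]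
  have 1: "prob (?A \<union> ?A' \<union> ?B) \<le> prob (?A \<union> ?A') + prob ?B"
    using sets by (intro measure_Un_le) auto
  have 2: "prob (?A \<union> ?A') \<le> prob ?A + prob ?A'"
    using sets by (intro measure_Un_le) auto
  have "prob ?A \<le> a" "prob ?A' \<le> a" "prob ?B \<le> eps j"
    by (rule a[OF R_Omega[OF rs(1)]] a[OF R_Omega[OF rs(2)]] prob_unlinked[OF x rs])+
  with 1 2 have "prob (?A \<union> ?A' \<union> ?B) \<le> 2 * a + eps j" by linarith
  then show "?A \<union> ?A' \<union> ?B \<in> sets P \<and> prob (?A \<union> ?A' \<union> ?B) \<le> 2 * a + eps j"
    using sets by simp
next
  show "{\<omega> \<in> space P. \<not> full j x \<omega>} \<subseteq> (\<Union>z\<in>{z \<in> R j x \<times> R j x. fst z \<noteq> snd z}.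
      {\<omega> \<in> space P. C j (fst z) \<omega> = {}} \<union> {\<omega> \<in> space P. C j (snd z) \<omega> = {}} \<union>
      {\<omega> \<in> space P. C j (fst z) \<omega> \<noteq> {} \<and> C j (snd z) \<omega> \<noteq> {} \<and> \<not> linked \<omega> (C j (fst z) \<omega>) (C j (snd z) \<omega>)})"
    by (auto simp: full_def)
next
  have "0 \<le> a" using a[OF x] by (rule order_trans[OF measure_nonneg])
  then show "0 \<le> 2 * a + eps j" using eps_pos[of j] by simp
qed

section \<open>Attachment to the chosen clusters around 0\<close>

definition attached :: "vertex \<Rightarrow> (edge \<Rightarrow> bool) \<Rightarrow> bool" where
  "attached x \<omega> \<longleftrightarrow>
    (\<exists>n. \<forall>i\<ge>n. C i zero_seq \<omega> \<noteq> {} \<and> C i zero_seq \<omega> \<subseteq> cluster N \<omega> x)"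

text \<open>Reduces uniqueness to attachment of infinite clusters. The nonemptiness required in
  \<open>attached\<close> provides a common vertex at a level beyond both thresholds.\<close>

lemma attached_same_cluster:
  assumes "attached x \<omega>" "attached y \<omega>"
  shows "cluster N \<omega> x = cluster N \<omega> y"
proof -
  obtain n k where n: "\<forall>i\<ge>n. C i zero_seq \<omega> \<noteq> {} \<and> C i zero_seq \<omega> \<subseteq> cluster N \<omega> x"
    and k: "\<forall>i\<ge>k. C i zero_seq \<omega> \<noteq> {} \<and> C i zero_seq \<omega> \<subseteq> cluster N \<omega> y"
    using assms by (auto simp: attached_def)
  have "max n k \<ge> n" "max n k \<ge> k" by auto
  then obtain z where "z \<in> cluster N \<omega> x" "z \<in> cluster N \<omega> y" using n k by blast
  then show ?thesis using cluster_eq by metis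
qed

text \<open>Fullness at level \<open>l\<close> absorbs the chosen cluster of \<open>B l y\<close>
  into that of \<open>B (Suc l) zero_seq\<close>, and fullness at later levels keeps
  \<open>y\<close> in all subsequent ones.\<close>

lemma attachedI:
  assumes "\<And>i. i \<ge> l \<Longrightarrow> full i zero_seq \<omega>"
    and y: "y \<in> B (Suc l) zero_seq" "y \<in> C l y \<omega>" "y \<in> cluster N \<omega> x"
  shows "attached x \<omega>"
proof -
  have mem: "y \<in> C i zero_seq \<omega>" if "i \<ge> Suc l" for i
    using that
  proof (induction i rule: dec_induct)
    case base
    then show ?case using full_subset'[OF zero_Omega y(1) assms(1)] y(2) by blast
  next
    case (step i)
    then show ?case
      using full_subset'[OF zero_Omega B_self[OF zero_Omega] assms(1), of i] by auto
  qed
  have "C i zero_seq \<omega> \<subseteq> cluster N \<omega> x" if "i \<ge> Suc l" for i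
    using C_connected[OF zero_Omega mem[OF that]] cluster_trans[OF y(3)] by blast
  with mem show ?thesis unfolding attached_def by blast
qed

lemma pred_attached [measurable]: "Measurable.pred P (attached x)"
proof -
  \<comment> \<open>Letting \<open>z\<close> range over the finite ball turns the inclusion into
    countably many measurable conditions.\<close>
  have "attached x = (\<lambda>\<omega>. \<exists>n. \<forall>i\<ge>n. C i zero_seq \<omega> \<noteq> {} \<and>
      (\<forall>z\<in>B i zero_seq. z \<in> C i zero_seq \<omega> \<longrightarrow> z \<in> cluster N \<omega> x))"
    unfolding attached_def fun_eq_iff using C_subset[OF zero_Omega] by blast
  moreover have [measurable]: "countable (B i zero_seq)" for i
    by (rule countable_finite[OF finite_B[OF zero_Omega]])
  moreover note [measurable] = pred_C[OF zero_Omega]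
  have [measurable]: "Measurable.pred P (\<lambda>\<omega>. z \<in> C i zero_seq \<omega>)" for i z
    by (rule pred_C[OF zero_Omega])
  have "Measurable.pred P (\<lambda>\<omega>. \<exists>n. \<forall>i\<ge>n. C i zero_seq \<omega> \<noteq> {} \<and>
      (\<forall>z\<in>B i zero_seq. z \<in> C i zero_seq \<omega> \<longrightarrow> z \<in> cluster N \<omega> x))"
    by measurable
  ultimately show ?thesis by simp
qed

text \<open>Take \<open>l + 1\<close> to be the least level whose ball around 0 contains
  \<open>y\<close>; then \<open>B l y\<close> and \<open>B l zero_seq\<close> are distinct subballs
  of one ball.\<close>

lemma exit_level:
  assumes "y \<in> Omega N" "y \<notin> B j zero_seq"
  shows "\<exists>l\<ge>j. y \<notin> B l zero_seq \<and> y \<in> B (Suc l) zero_seq"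
proof -
  obtain k where "y \<in> hball N k zero_seq" using assms(1) Omega_eq_UN_hball[OF zero_Omega] by blast
  moreover have "k \<le> k * m" using m_pos by simp
  ultimately have "y \<in> B k zero_seq" using hball_mono[of k "k * m" N zero_seq] by (auto simp: B_def)
  moreover have "y \<notin> B 0 zero_seq" using assms(2) B_mono[of 0 j zero_seq] by auto
  ultimately obtain l where l: "\<forall>i\<le>l. y \<notin> B i zero_seq" "y \<in> B (Suc l) zero_seq"
    using ex_least_nat_less[of "\<lambda>i. y \<in> B i zero_seq" k] by blast
  have "j \<le> l"
  proof (rule ccontr)
    assume "\<not> j \<le> l"
    then show False using l(2) assms(2) B_mono[of "Suc l" j zero_seq] by auto
  qed
  then show ?thesis using l by blast
qed

end

section \<open>Percolation and uniqueness\<close>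

text \<open>With \<open>a = (1/2)^j / (16 M^2)\<close> the assumption reads
  \<open>eps j \<le> a / (4 M^2)\<close>, the size at which the recursion for bad balls
  closes.\<close>

locale renormalization_small = renormalization +
  assumes eps_le: "\<And>j. eps j \<le> (1 / 2) ^ j / (64 * real (N ^ m) ^ 4)"
begin

text \<open>Level 0 is never bad. Since \<open>M^2 a \<le> 1/16\<close>, the recursion multiplies
  the bound by at most \<open>1/16 + 1/4\<close>, which is below \<open>1/2\<close>.\<close>

lemma prob_C_empty:
  "x \<in> Omega N \<Longrightarrow> prob {\<omega> \<in> space P. C j x \<omega> = {}} \<le> (1 / 2) ^ j / (16 * real M ^ 2)"
proof (induction j arbitrary: x)
  case 0
  then show ?case by simp
next
  case (Suc j)
  define a :: real where "a = (1 / 2) ^ j / (16 * real M ^ 2)"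
  have M: "real M \<ge> 3" using M3 by (simp flip: of_nat_power)
  then have a0: "a \<ge> 0" by (simp add: a_def)
  have "prob {\<omega> \<in> space P. C (Suc j) x \<omega> = {}} \<le> real M ^ 2 * (a\<^sup>2 + eps j)"
    using Suc by (intro prob_C_empty_Suc) (auto simp: a_def)
  also have "\<dots> \<le> real M ^ 2 * (a\<^sup>2 + a / (4 * real M ^ 2))"
    using eps_le[of j] M by (intro mult_left_mono add_left_mono) (auto simp: a_def power2_eq_square power4_eq_xxxx)
  also have "\<dots> = a * (real M ^ 2 * a + 1 / 4)"
    using N2 by (simp add: distrib_left power2_eq_square)
  also have "\<dots> = a * ((1 / 2) ^ j / 16 + 1 / 4)" using N2 by (simp add: a_def)
  also have "a * ((1 / 2) ^ j / 16 + 1 / 4) \<le> a * (1 / 2)"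
  proof (rule mult_left_mono[OF _ a0])
    have "(1 / 2) ^ j \<le> (1::real)" by (rule power_le_one) auto
    then show "(1 / 2) ^ j / 16 + 1 / 4 \<le> (1 / 2 :: real)" by simp
  qed
  also have "a * (1 / 2) = (1 / 2) ^ Suc j / (16 * real M ^ 2)" by (simp add: a_def)
  finally show ?case .
qed

lemma prob_not_full_le: "x \<in> Omega N \<Longrightarrow> prob {\<omega> \<in> space P. \<not> full j x \<omega>} \<le> 3 / 16 * (1 / 2) ^ j"
proof -
  assume x: "x \<in> Omega N"
  define a :: real where "a = (1 / 2) ^ j / (16 * real M ^ 2)"
  have M: "real M \<ge> 3" using M3 by (simp flip: of_nat_power)
  then have a0: "a \<ge> 0" by (simp add: a_def)
  have "1 \<le> real M ^ 2" using M by (intro one_le_power) auto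
  then have "1 \<le> 4 * real M ^ 2" by linarith
  then have "a / (4 * real M ^ 2) \<le> a / 1" using a0 N2 by (intro divide_left_mono) auto
  moreover have "eps j \<le> a / (4 * real M ^ 2)"
    using eps_le[of j] by (simp add: a_def power2_eq_square power4_eq_xxxx)
  ultimately have e: "eps j \<le> a" by simp
  have "prob {\<omega> \<in> space P. \<not> full j x \<omega>} \<le> real M ^ 2 * (2 * a + eps j)"
    using prob_C_empty x by (intro prob_not_full) (auto simp: a_def)
  also have "\<dots> \<le> real M ^ 2 * (3 * a)" using e by (intro mult_left_mono) auto
  also have "\<dots> = 3 / 16 * (1 / 2) ^ j" using N2 by (simp add: a_def)
  finally show ?thesis .
qed

text \<open>A geometric sum. At \<open>j = 0\<close> it leaves probability at least 5/8, for any
  \<open>x\<close>, that all levels are full.\<close>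

lemma prob_not_full_tail:
  assumes x: "x \<in> Omega N"
  shows "prob {\<omega> \<in> space P. \<exists>i\<ge>j. \<not> full i x \<omega>} \<le> 3 / 8 * (1 / 2) ^ j"
proof -
  note [measurable] = pred_full[OF x]
  have S: "{\<omega> \<in> space P. \<not> full i x \<omega>} \<in> sets P" for i by measurable
  have sums: "(\<lambda>i. 3 / 16 * (1 / 2) ^ j * (1 / 2 :: real) ^ i) sums (3 / 16 * (1 / 2) ^ j * (1 / (1 - 1 / 2)))"
    by (intro sums_mult geometric_sums) auto
  have le: "prob {\<omega> \<in> space P. \<not> full (j + i) x \<omega>} \<le> 3 / 16 * (1 / 2) ^ j * (1 / 2) ^ i" for i
    using prob_not_full_le[OF x, of "j + i"] by (simp add: power_add)
  have summ: "summable (\<lambda>i. prob {\<omega> \<in> space P. \<not> full (j + i) x \<omega>})"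
    using le by (intro summable_comparison_test'[OF sums_summable[OF sums]]) auto
  have eq: "{\<omega> \<in> space P. \<exists>i\<ge>j. \<not> full i x \<omega>} = (\<Union>i. {\<omega> \<in> space P. \<not> full (j + i) x \<omega>})"
    by (auto simp: le_iff_add)
  have "prob {\<omega> \<in> space P. \<exists>i\<ge>j. \<not> full i x \<omega>} \<le> (\<Sum>i. prob {\<omega> \<in> space P. \<not> full (j + i) x \<omega>})"
    unfolding eq using S summ by (intro finite_measure_subadditive_countably) auto
  also have "\<dots> \<le> (\<Sum>i. 3 / 16 * (1 / 2) ^ j * (1 / 2) ^ i)"
    by (intro suminf_le le summ sums_summable[OF sums])
  also have "\<dots> = 3 / 8 * (1 / 2) ^ j" using sums_unique[OF sums, symmetric] by simp
  finally show ?thesis .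
qed

text \<open>When all levels around 0 are full, 0 lies in chosen clusters with at least
  \<open>2^j\<close> vertices for every \<open>j\<close>.\<close>

lemma percolation: "prob (perc_event N \<delta> c) > 0"
proof -
  note [measurable] = pred_full[OF zero_Omega]
  let ?F = "{\<omega> \<in> space P. \<exists>i\<ge>0. \<not> full i zero_seq \<omega>}"
  have F: "?F \<in> sets P" by measurable
  have "space P - ?F \<subseteq> perc_event N \<delta> c"
  proof
    fix \<omega> assume \<omega>: "\<omega> \<in> space P - ?F"
    then have full: "full i zero_seq \<omega>" for i by auto
    have sub: "C j zero_seq \<omega> \<subseteq> cluster N \<omega> zero_seq" for j
      using C_connected[OF zero_Omega full_chain[OF zero_Omega full]] by blast
    have card: "card (C j zero_seq \<omega>) \<ge> 2 ^ j" for j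
    proof -
      have "(2::nat) ^ j \<le> (M - 1) ^ j" using M3 by (intro power_mono) auto
      also have "\<dots> \<le> card (C j zero_seq \<omega>)"
        using full_chain[OF zero_Omega full] by (intro C_card) auto
      finally show ?thesis .
    qed
    have "infinite (cluster N \<omega> zero_seq)"
    proof
      assume fin: "finite (cluster N \<omega> zero_seq)"
      let ?n = "card (cluster N \<omega> zero_seq)"
      have "2 ^ ?n \<le> ?n" using card[of ?n] card_mono[OF fin sub[of ?n]] by linarith
      then show False using less_exp[of ?n] by simp
    qed
    then show "\<omega> \<in> perc_event N \<delta> c" using \<omega> by (simp add: perc_event_def G_eq)
  qed
  then have "prob (space P - ?F) \<le> prob (perc_event N \<delta> c)"
    by (rule finite_measure_mono[OF _ perc_event_sets])
  moreover have "prob (space P - ?F) = 1 - prob ?F" by (rule prob_compl[OF F])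
  moreover have "prob ?F \<le> 3 / 8" using prob_not_full_tail[OF zero_Omega, of 0] by simp
  ultimately show ?thesis by linarith
qed

text \<open>The first vertex \<open>y\<close> outside \<open>B j 0\<close> reached from \<open>x\<close> is determined by the edges touching
  \<open>B j 0\<close>. The edges inside the largest ball \<open>B l y\<close> that misses \<open>0\<close> are independent of these, and
  with probability at least 5/8 they connect \<open>y\<close> to the chosen cluster of \<open>B l y\<close>.\<close>

lemma prob_escape_unattached:
  assumes x: "x \<in> B j zero_seq"
    and dep: "depends_on {e \<in> edges N. e \<inter> B j zero_seq \<noteq> {}} \<Phi>" and \<Phi>[measurable]: "Measurable.pred P \<Phi>"
  shows "prob {\<omega> \<in> space P. \<Phi> \<omega> \<and> infinite (cluster N \<omega> x) \<and> \<not> attached x \<omega>}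
    \<le> 3 / 8 * prob {\<omega> \<in> space P. \<Phi> \<omega>} + 3 / 8 * (1 / 2) ^ j"
proof -
  let ?A = "B j zero_seq"
  let ?S = "{e \<in> edges N. e \<inter> ?A \<noteq> {}}"
  define D where "D = Omega N - ?A"
  have xO: "x \<in> Omega N" using x B_Omega by blast
  have reach: "\<exists>z\<in>D. z \<in> cluster N (\<lambda>e. \<omega> e \<and> e \<inter> ?A \<noteq> {}) x" if "infinite (cluster N \<omega> x)" for \<omega>
  proof -
    have "\<not> cluster N \<omega> x \<subseteq> ?A" using that finite_B[OF zero_Omega] finite_subset by blast
    then obtain y where "y \<in> cluster N \<omega> x" "y \<notin> ?A" by blast
    from cluster_exit[OF x this] show ?thesis unfolding D_def by blast
  qed
  show ?thesis
  proof (cases "D = {}")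
    case True
    then have "{\<omega> \<in> space P. \<Phi> \<omega> \<and> infinite (cluster N \<omega> x) \<and> \<not> attached x \<omega>} = {}"
      using reach by blast
    then show ?thesis by (simp only: measure_empty) simp
  next
    case False
    have cD: "countable D" using countable_Omega by (simp add: D_def)
    define f where "f = from_nat_into D"
    have rf: "range f = D" unfolding f_def by (rule range_from_nat_into[OF False cD])
    have fD: "f n \<in> Omega N" "f n \<notin> ?A" for n using rf by (auto simp: D_def)
    have "\<forall>n. \<exists>l\<ge>j. f n \<notin> B l zero_seq \<and> f n \<in> B (Suc l) zero_seq"
      using exit_level[OF fD] by blast
    then obtain l where l: "\<And>n. l n \<ge> j" "\<And>n. f n \<notin> B (l n) zero_seq" "\<And>n. f n \<in> B (Suc (l n)) zero_seq"
      by metis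
    define X where "X y \<omega> \<longleftrightarrow> y \<in> cluster N (\<lambda>e. \<omega> e \<and> e \<inter> ?A \<noteq> {}) x" for y and \<omega> :: "edge \<Rightarrow> bool"
    \<comment> \<open>"First" refers to the enumeration \<open>f\<close>: \<open>f n\<close> is the
      first enumerated vertex outside the ball that is reached through edges touching it. This makes
      the events \<open>W n\<close> disjoint.\<close>
    define W where "W n \<omega> \<longleftrightarrow> \<Phi> \<omega> \<and> X (f n) \<omega> \<and> (\<forall>k<n. \<not> X (f k) \<omega>)" for n \<omega>
    define Y where "Y n \<omega> \<longleftrightarrow> f n \<in> C (l n) (f n) \<omega>" for n \<omega>
    have pX[measurable]: "Measurable.pred P (X y)" for y
      unfolding X_def
    proof (rule pred_cluster)
      fix e assume "e \<in> edges N"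
      then have [measurable]: "Measurable.pred P (\<lambda>\<omega>. \<omega> e)" by (rule pred_component)
      show "Measurable.pred P (\<lambda>\<omega>. \<omega> e \<and> e \<inter> ?A \<noteq> {})" by measurable
    qed
    have pW[measurable]: "Measurable.pred P (W n)" for n unfolding W_def by measurable
    have pY[measurable]: "Measurable.pred P (Y n)" for n unfolding Y_def by (rule pred_C[OF fD(1)])
    have pnY: "Measurable.pred P (\<lambda>\<omega>. \<not> Y n \<omega>)" for n by measurable
    have dX: "depends_on ?S (X y)" for y
    proof (rule depends_onI)
      fix \<omega> \<omega>' :: "edge \<Rightarrow> bool" assume "\<And>e. e \<in> ?S \<Longrightarrow> \<omega> e = \<omega>' e"
      then show "X y \<omega> = X y \<omega>'"
        unfolding X_def by (subst cluster_cong_edges[of N _ "\<lambda>e. \<omega>' e \<and> e \<inter> ?A \<noteq> {}"]) auto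
    qed
    have dW: "depends_on ?S (W n)" for n
    proof (rule depends_onI)
      fix \<omega> \<omega>' :: "edge \<Rightarrow> bool" assume eq: "\<And>e. e \<in> ?S \<Longrightarrow> \<omega> e = \<omega>' e"
      have "X y \<omega> = X y \<omega>'" for y by (rule depends_onD[OF dX eq])
      moreover have "\<Phi> \<omega> = \<Phi> \<omega>'" by (rule depends_onD[OF dep eq])
      ultimately show "W n \<omega> = W n \<omega>'" by (simp add: W_def)
    qed
    have dY: "depends_on (inner_edges (l n) (f n)) (\<lambda>\<omega>. \<not> Y n \<omega>)" for n
    proof (rule depends_onI)
      fix \<omega> \<omega>' :: "edge \<Rightarrow> bool" assume eq: "\<And>e. e \<in> inner_edges (l n) (f n) \<Longrightarrow> \<omega> e = \<omega>' e"
      have "C (l n) (f n) \<omega> = C (l n) (f n) \<omega>'" by (rule depends_onD[OF C_depends[OF fD(1)] eq])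
      then show "(\<not> Y n \<omega>) = (\<not> Y n \<omega>')" by (simp add: Y_def)
    qed
    \<comment> \<open>A common edge would have an endpoint in both balls, forcing the level
      \<open>l n\<close> balls around \<open>f n\<close> and 0 to coincide, contrary to the choice
      of \<open>l n\<close>.\<close>
    have disj: "?S \<inter> inner_edges (l n) (f n) = {}" for n
    proof (rule ccontr)
      assume "?S \<inter> inner_edges (l n) (f n) \<noteq> {}"
      then obtain z where z: "z \<in> ?A" "z \<in> B (l n) (f n)" by (auto simp: inner_edges_def)
      then have "B (l n) z = B (l n) zero_seq" using B_cong B_mono[OF l(1)[of n]] by blast
      moreover have "B (l n) z = B (l n) (f n)" using B_cong z(2) by blast
      ultimately show False using B_self[OF fD(1)[of n], of "l n"] l(2)[of n] by simp
    qed
    have nY: "prob {\<omega> \<in> space P. \<not> Y n \<omega>} \<le> 3 / 8" for n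
    proof -
      note [measurable] = pred_full[OF fD(1)]
      have "{\<omega> \<in> space P. \<not> Y n \<omega>} \<subseteq> {\<omega> \<in> space P. \<exists>i\<ge>0. \<not> full i (f n) \<omega>}"
        using full_chain[OF fD(1)[of n], of "l n"] unfolding Y_def by blast
      then have "prob {\<omega> \<in> space P. \<not> Y n \<omega>} \<le> prob {\<omega> \<in> space P. \<exists>i\<ge>0. \<not> full i (f n) \<omega>}"
        by (rule finite_measure_mono) measurable
      then show ?thesis using prob_not_full_tail[OF fD(1)[of n], of 0] by simp
    qed
    have WY: "prob {\<omega> \<in> space P. W n \<omega> \<and> \<not> Y n \<omega>} \<le> prob {\<omega> \<in> space P. W n \<omega>} * (3 / 8)" for n
    proof -
      have "prob {\<omega> \<in> space P. W n \<omega> \<and> \<not> Y n \<omega>} = prob {\<omega> \<in> space P. W n \<omega>} * prob {\<omega> \<in> space P. \<not> Y n \<omega>}"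
        by (rule prob_indep[OF disj _ inner_edges_sub dW dY pW pnY]) auto
      also have "\<dots> \<le> prob {\<omega> \<in> space P. W n \<omega>} * (3 / 8)"
        by (rule mult_left_mono[OF nY]) simp
      finally show ?thesis .
    qed
    let ?W = "\<lambda>n. {\<omega> \<in> space P. W n \<omega>}"
    let ?WY = "\<lambda>n. {\<omega> \<in> space P. W n \<omega> \<and> \<not> Y n \<omega>}"
    let ?H = "{\<omega> \<in> space P. \<exists>i\<ge>j. \<not> full i zero_seq \<omega>}"
    note [measurable] = pred_full[OF zero_Omega]
    have mW: "?W n \<in> sets P" "?WY n \<in> sets P" for n by measurable
    have mH: "?H \<in> sets P" by measurable
    have disjW: "disjoint_family ?W"
    proof -
      have "a = b" if "W a \<omega>" "W b \<omega>" for a b \<omega>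
        using that by (metis W_def linorder_neqE_nat)
      then show ?thesis by (auto simp: disjoint_family_on_def)
    qed
    have sumW: "(\<lambda>n. prob (?W n)) sums prob (\<Union>n. ?W n)"
      using mW disjW by (intro finite_measure_UNION) auto
    then have sumW': "(\<lambda>n. prob (?W n) * (3 / 8)) sums (prob (\<Union>n. ?W n) * (3 / 8))"
      by (rule sums_mult2)
    have summ: "summable (\<lambda>n. prob (?WY n))"
      using WY by (intro summable_comparison_test'[OF sums_summable[OF sumW']]) auto
    \<comment> \<open>Off \<open>?H\<close> all levels from \<open>j\<close> on are full around 0,
      so success of \<open>Y n\<close> would attach \<open>x\<close> by
      \<open>attachedI\<close>.\<close>
    have sub: "{\<omega> \<in> space P. \<Phi> \<omega> \<and> infinite (cluster N \<omega> x) \<and> \<not> attached x \<omega>} \<subseteq> (\<Union>n. ?WY n) \<union> ?H"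
    proof
      fix \<omega> assume \<omega>: "\<omega> \<in> {\<omega> \<in> space P. \<Phi> \<omega> \<and> infinite (cluster N \<omega> x) \<and> \<not> attached x \<omega>}"
      show "\<omega> \<in> (\<Union>n. ?WY n) \<union> ?H"
      proof (cases "\<omega> \<in> ?H")
        case False
        then have full: "full i zero_seq \<omega>" if "i \<ge> j" for i using that \<omega> by blast
        have "infinite (cluster N \<omega> x)" using \<omega> by simp
        from reach[OF this] obtain z where z: "z \<in> D" "X z \<omega>" unfolding X_def by blast
        then obtain k where "X (f k) \<omega>" unfolding rf[symmetric] by blast
        then obtain n where n: "X (f n) \<omega>" "\<forall>k<n. \<not> X (f k) \<omega>"
          using exists_least_iff[of "\<lambda>n. X (f n) \<omega>"] by blast
        have "f n \<in> cluster N \<omega> x"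
          using n(1) cluster_mono[of "\<lambda>e. \<omega> e \<and> e \<inter> ?A \<noteq> {}" \<omega> N x] by (auto simp: X_def)
        then have "\<not> Y n \<omega>"
          using attachedI[of "l n" \<omega> "f n" x] full l(1,3)[of n] \<omega> by (auto simp: Y_def)
        moreover have "W n \<omega>" using n \<omega> by (simp add: W_def)
        ultimately show ?thesis using \<omega> by blast
      qed blast
    qed
    have "prob {\<omega> \<in> space P. \<Phi> \<omega> \<and> infinite (cluster N \<omega> x) \<and> \<not> attached x \<omega>} \<le> prob ((\<Union>n. ?WY n) \<union> ?H)"
      using mW mH by (intro finite_measure_mono[OF sub]) auto
    also have "\<dots> \<le> prob (\<Union>n. ?WY n) + prob ?H"
      using mW mH by (intro measure_Un_le) auto
    finally have 1: "prob {\<omega> \<in> space P. \<Phi> \<omega> \<and> infinite (cluster N \<omega> x) \<and> \<not> attached x \<omega>} \<le> \<dots>" .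
    have "prob (\<Union>n. ?WY n) \<le> (\<Sum>n. prob (?WY n))"
      using mW summ by (intro finite_measure_subadditive_countably) auto
    also have "\<dots> \<le> (\<Sum>n. prob (?W n) * (3 / 8))"
      by (intro suminf_le WY summ sums_summable[OF sumW'])
    also have "\<dots> = prob (\<Union>n. ?W n) * (3 / 8)" using sums_unique[OF sumW'] by simp
    also have "\<dots> \<le> prob {\<omega> \<in> space P. \<Phi> \<omega>} * (3 / 8)"
      using \<Phi> by (intro mult_right_mono finite_measure_mono) (auto simp: W_def pred_def)
    finally show ?thesis using 1 prob_not_full_tail[OF zero_Omega, of j] by linarith
  qed
qed

text \<open>Approximate the event by some \<open>\<Phi>\<close> on finitely many edges and choose
  \<open>j\<close> so large that \<open>B j zero_seq\<close> contains \<open>x\<close> and all of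
  these. Then \<open>prob_escape_unattached\<close> bounds the probability by about 3/8 of
  itself.\<close>

lemma prob_infinite_unattached:
  assumes x: "x \<in> Omega N"
  shows "prob {\<omega> \<in> space P. infinite (cluster N \<omega> x) \<and> \<not> attached x \<omega>} = 0"
proof (rule ccontr)
  let ?U = "{\<omega> \<in> space P. infinite (cluster N \<omega> x) \<and> \<not> attached x \<omega>}"
  assume "prob ?U \<noteq> 0"
  then have pos: "prob ?U / 8 > 0" using measure_nonneg[of P ?U] by linarith
  note [measurable] = pred_infinite[OF x]
  have U[measurable]: "?U \<in> sets P" by measurable
  obtain S \<Phi> where S: "finite S" "S \<subseteq> edges N" "depends_on S \<Phi>"
    and ap: "prob {\<omega> \<in> space P. \<Phi> \<omega> \<noteq> (\<omega> \<in> ?U)} < prob ?U / 8"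
    using approx_by_finite[OF U pos] by blast
  have \<Phi>[measurable]: "Measurable.pred P \<Phi>" by (rule pred_finite[OF S])
  let ?T = "{\<omega> \<in> space P. \<Phi> \<omega> \<noteq> (\<omega> \<in> ?U)}"
  have T: "?T \<in> sets P" by measurable
  have "finite (insert x (\<Union>S))" "insert x (\<Union>S) \<subseteq> Omega N"
    using S(1,2) x by (auto simp: edges_def)
  then obtain k where k: "insert x (\<Union>S) \<subseteq> hball N k zero_seq"
    using finite_subset_hball[OF zero_Omega] by metis
  obtain n where n: "(1 / 2) ^ n < prob ?U / 8" using real_arch_pow_inv[OF pos, of "1/2"] by auto
  define j where "j = max k n"
  have "k * 1 \<le> j * m" using m_pos by (intro mult_le_mono) (auto simp: j_def)
  then have kB: "insert x (\<Union>S) \<subseteq> B j zero_seq" 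
    using k hball_mono[of k "j * m" N zero_seq] unfolding B_def by (metis mult.right_neutral order_trans)
  have "(1 / 2 :: real) ^ j \<le> (1 / 2) ^ n" by (rule power_decreasing) (auto simp: j_def)
  then have j: "(1 / 2) ^ j < prob ?U / 8" using n by linarith
  have "S \<subseteq> {e \<in> edges N. e \<inter> B j zero_seq \<noteq> {}}"
  proof
    fix e assume e: "e \<in> S"
    then have "e \<in> edges N" "e \<subseteq> B j zero_seq" using S(2) kB by auto
    moreover have "e \<noteq> {}" using \<open>e \<in> edges N\<close> by (auto simp: edges_def)
    ultimately show "e \<in> {e \<in> edges N. e \<inter> B j zero_seq \<noteq> {}}" by blast
  qed
  from depends_on_mono[OF S(3) this] kB
  have 1: "prob {\<omega> \<in> space P. \<Phi> \<omega> \<and> infinite (cluster N \<omega> x) \<and> \<not> attached x \<omega>}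
    \<le> 3 / 8 * prob {\<omega> \<in> space P. \<Phi> \<omega>} + 3 / 8 * (1 / 2) ^ j"
    by (intro prob_escape_unattached \<Phi>) auto
  let ?V = "{\<omega> \<in> space P. \<Phi> \<omega> \<and> infinite (cluster N \<omega> x) \<and> \<not> attached x \<omega>}"
  have V: "?V \<in> sets P" by measurable
  have "prob ?U \<le> prob (?V \<union> ?T)" using V T by (intro finite_measure_mono) auto
  also have "\<dots> \<le> prob ?V + prob ?T" by (rule measure_Un_le[OF V T])
  finally have 2: "prob ?U \<le> prob ?V + prob ?T" .
  have "prob {\<omega> \<in> space P. \<Phi> \<omega>} \<le> prob (?U \<union> ?T)" using U T by (intro finite_measure_mono) auto
  also have "\<dots> \<le> prob ?U + prob ?T" by (rule measure_Un_le[OF U T])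
  finally have 3: "prob {\<omega> \<in> space P. \<Phi> \<omega>} \<le> prob ?U + prob ?T" .
  \<comment> \<open>With \<open>u = prob ?U\<close> the bounds give
    \<open>u < 3/8 (u + u/8) + 3/8 u/8 + u/8 = 19/32 u\<close>.\<close>
  from 1 2 3 ap j pos show False by linarith
qed

text \<open>Discarding one null set for each of the countably many vertices leaves only attached
  infinite clusters.\<close>

lemma uniqueness:
  "AE \<omega> in P. \<forall>x\<in>Omega N. \<forall>y\<in>Omega N.
    infinite (cluster N \<omega> x) \<and> infinite (cluster N \<omega> y) \<longrightarrow> cluster N \<omega> x = cluster N \<omega> y"
proof -
  have "AE \<omega> in P. \<forall>x\<in>Omega N. \<not> (infinite (cluster N \<omega> x) \<and> \<not> attached x \<omega>)"
    unfolding AE_ball_countable[OF countable_Omega]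
  proof
    fix x assume x: "x \<in> Omega N"
    note [measurable] = pred_infinite[OF x]
    have "{\<omega> \<in> space P. infinite (cluster N \<omega> x) \<and> \<not> attached x \<omega>} \<in> null_sets P"
      using prob_infinite_unattached[OF x] by (auto simp: null_sets_def emeasure_eq_measure)
    then show "AE \<omega> in P. \<not> (infinite (cluster N \<omega> x) \<and> \<not> attached x \<omega>)"
      by (rule AE_I') auto
  qed
  then show ?thesis
    by eventually_elim (use attached_same_cluster in blast)
qed

end

section \<open>Choice of the block size\<close>

text \<open>If \<open>m > 2 / (1 - \<delta>)\<close> then \<open>M^(1 - \<delta>) > 4\<close>, that
  is \<open>(M/2)^2 > M^(1 + \<delta>)\<close>, and \<open>M - 1 \<ge> M/2\<close>.\<close>

lemma block_size_exists:
  fixes N :: nat and \<delta> :: real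
  assumes "N \<ge> 2" "-1 < \<delta>" "\<delta> < 1"
  shows "\<exists>m. N ^ m \<ge> 3 \<and> real (N ^ m - 1) ^ 2 > real (N ^ m) powr (1 + \<delta>)"
proof -
  obtain m :: nat where m: "real m > 2 / (1 - \<delta>)" using reals_Archimedean2 by blast
  have "2 / (1 - \<delta>) > 1" using assms by (simp add: field_simps)
  then have "m \<ge> 2" using m by linarith
  have "(2::nat) ^ 2 \<le> 2 ^ m" using \<open>m \<ge> 2\<close> by (rule power_increasing) simp
  also have "\<dots> \<le> N ^ m" using assms(1) by (rule power_mono) simp
  finally have M: "N ^ m \<ge> 4" by simp
  define M where "M = real (N ^ m)"
  have M4: "M \<ge> 4" using M unfolding M_def by (metis of_nat_le_iff of_nat_numeral)
  have "(4::real) = 2 powr 2" by simp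
  also have "\<dots> < 2 powr (real m * (1 - \<delta>))"
    using m assms by (intro powr_less_mono) (auto simp: field_simps)
  also have "\<dots> \<le> real N powr (real m * (1 - \<delta>))"
    using assms by (intro powr_mono2) auto
  also have "\<dots> = M powr (1 - \<delta>)"
    using assms by (simp add: M_def powr_powr flip: powr_realpow)
  finally have "4 * M powr (1 + \<delta>) < M powr (1 - \<delta>) * M powr (1 + \<delta>)"
    using M4 by (intro mult_strict_right_mono) auto
  also have "\<dots> = M powr ((1 - \<delta>) + (1 + \<delta>))" by (rule powr_add[symmetric])
  also have "\<dots> = M ^ 2" using M4 by simp
  finally have "M powr (1 + \<delta>) < (M / 2) ^ 2" by (simp add: power_divide)
  also have "\<dots> \<le> (M - 1) ^ 2" using M4 by (intro power_mono) auto
  also have "M - 1 = real (N ^ m - 1)" using M by (simp add: M_def of_nat_diff)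
  finally have "real (N ^ m - 1) ^ 2 > real (N ^ m) powr (1 + \<delta>)" by (simp only: M_def)
  with M show ?thesis by (intro exI[of _ m]) auto
qed

text \<open>With \<open>c0 = \<kappa> Q\<close> the exponent in \<open>eps j\<close> is
  \<open>\<kappa> \<rho>^j\<close>, where \<open>\<rho> > 1\<close> is the growth rate of the
  expected number of links. It has to exceed \<open>ln L + j ln 2\<close>.\<close>

lemma renormalization_exists:
  fixes N :: nat and \<delta> :: real
  assumes N: "N \<ge> 2" and \<delta>: "-1 < \<delta>" "\<delta> < 1"
  shows "\<exists>m c0. \<forall>c. (\<forall>k\<ge>1. c k > 0) \<and> (\<forall>k\<ge>1. c k \<ge> c0) \<longrightarrow> renormalization_small N \<delta> c m c0"
proof -
  obtain m where M3: "N ^ m \<ge> 3" and M: "real (N ^ m - 1) ^ 2 > real (N ^ m) powr (1 + \<delta>)"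
    using block_size_exists[OF assms] by blast
  define Q where "Q = real (N ^ m) powr (1 + \<delta>)"
  define \<rho> where "\<rho> = real (N ^ m - 1) ^ 2 / Q"
  define L where "L = 64 * real (N ^ m) ^ 4"
  have "real (N ^ m) \<ge> 1" using M3 by (metis of_nat_1 of_nat_le_iff one_le_numeral order_trans)
  then have Q: "Q > 0" and "1 \<le> real (N ^ m) ^ 4"
    using N one_le_power[of "real (N ^ m)" 4] by (auto simp: Q_def)
  then have L: "L \<ge> 1" unfolding L_def by linarith
  have \<rho>: "\<rho> > 1" using M Q unfolding \<rho>_def Q_def[symmetric] by (subst less_divide_eq_1_pos)
  \<comment> \<open>After Bernoulli's inequality \<open>\<rho>^j \<ge> 1 + j (\<rho> - 1)\<close>,
    the first summand pays for \<open>ln L\<close> and the second for \<open>j ln 2\<close>.\<close>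
  define \<kappa> where "\<kappa> = ln L + ln 2 / (\<rho> - 1)"
  have \<kappa>: "\<kappa> > 0" using L \<rho> by (simp add: \<kappa>_def add_nonneg_pos)
  have eps: "exp (- (\<kappa> * Q * real (N ^ m - 1) ^ (2 * j) / real N powr (real (Suc j * m) * (1 + \<delta>))))
      \<le> (1 / 2) ^ j / L" for j
  proof -
    have "Q = real N powr (real m * (1 + \<delta>))"
      using N by (simp add: Q_def powr_powr flip: powr_realpow)
    moreover have "Q ^ Suc j = Q powr real (Suc j)" by (rule powr_realpow[OF Q, symmetric])
    ultimately have "real N powr (real (Suc j * m) * (1 + \<delta>)) = Q ^ Suc j"
      by (simp only: powr_powr of_nat_mult mult_ac)
    then have "\<kappa> * Q * real (N ^ m - 1) ^ (2 * j) / real N powr (real (Suc j * m) * (1 + \<delta>)) = \<kappa> * \<rho> ^ j"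
      using Q by (simp add: \<rho>_def power_divide power_mult)
    moreover have "\<kappa> * \<rho> ^ j \<ge> ln L + real j * ln 2"
    proof -
      have "1 + real j * (\<rho> - 1) \<le> \<rho> ^ j" using Bernoulli_inequality[of "\<rho> - 1" j] \<rho> by simp
      then have "\<kappa> * (1 + real j * (\<rho> - 1)) \<le> \<kappa> * \<rho> ^ j" using \<kappa> by (intro mult_left_mono) auto
      moreover have "\<kappa> * (1 + real j * (\<rho> - 1)) = ln L + ln 2 / (\<rho> - 1) + real j * (\<rho> - 1) * ln L + real j * ln 2"
        using \<rho> by (simp add: \<kappa>_def field_simps)
      moreover have "ln 2 / (\<rho> - 1) \<ge> 0" "real j * (\<rho> - 1) * ln L \<ge> 0" using \<rho> L by auto
      ultimately show ?thesis by linarith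
    qed
    ultimately have "exp (- (\<kappa> * Q * real (N ^ m - 1) ^ (2 * j) / real N powr (real (Suc j * m) * (1 + \<delta>))))
      \<le> exp (- (ln L + real j * ln 2))" by simp
    also have "\<dots> = inverse (L * 2 ^ j)"
      using L unfolding exp_minus by (simp add: exp_add exp_of_nat_mult)
    also have "\<dots> = (1 / 2) ^ j / L"
      by (simp add: power_one_over field_simps)
    finally show ?thesis .
  qed
  have "renormalization_small N \<delta> c m (\<kappa> * Q)"
    if c: "\<And>k. k \<ge> 1 \<Longrightarrow> c k > 0" "\<And>k. k \<ge> 1 \<Longrightarrow> c k \<ge> \<kappa> * Q" for c
  proof -
    interpret renormalization N \<delta> c m "\<kappa> * Q"
      using N \<delta> M3 \<kappa> Q c by unfold_locales auto
    show ?thesis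
      using eps by unfold_locales (simp add: eps_def L_def)
  qed
  then show ?thesis by (intro exI[of _ m] exI[of _ "\<kappa> * Q"]) auto
qed

theorem theorem3p1:
  fixes N :: nat and \<delta> :: real
  assumes "N \<ge> 2" and "\<delta> > -1"
  shows
    "(\<delta> > 1 \<longrightarrow>
       (\<forall>c :: nat \<Rightarrow> real. (\<forall>k\<ge>1. c k > 0) \<and> (\<exists>B. \<forall>k\<ge>1. c k \<le> B) \<longrightarrow>
          perc_event N \<delta> c \<in> sets (G N \<delta> c) \<and>
          measure (G N \<delta> c) (perc_event N \<delta> c) = 0))
   \<and> (\<delta> < 1 \<longrightarrow>
       (\<exists>C :: real. \<forall>c :: nat \<Rightarrow> real. (\<forall>k\<ge>1. c k > 0) \<and> (\<forall>k\<ge>1. c k \<ge> C) \<longrightarrow>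
          perc_event N \<delta> c \<in> sets (G N \<delta> c) \<and>
          measure (G N \<delta> c) (perc_event N \<delta> c) > 0 \<and>
          (AE \<omega> in G N \<delta> c. \<forall>x\<in>Omega N. \<forall>y\<in>Omega N.
              infinite (cluster N \<omega> x) \<and> infinite (cluster N \<omega> y) \<longrightarrow>
              cluster N \<omega> x = cluster N \<omega> y)))"
proof (intro conjI impI allI)
  fix c :: "nat \<Rightarrow> real"
  assume "\<delta> > 1" and c: "(\<forall>k\<ge>1. c k > 0) \<and> (\<exists>B. \<forall>k\<ge>1. c k \<le> B)"
  interpret hierarchical N \<delta> c using assms(1) c by unfold_locales auto
  show "perc_event N \<delta> c \<in> sets (G N \<delta> c)" using perc_event_sets by (simp add: G_eq)
  obtain B where "\<And>k. k \<ge> 1 \<Longrightarrow> c k \<le> B" using c by blast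
  from no_percolation[OF \<open>\<delta> > 1\<close> this]
  show "measure (G N \<delta> c) (perc_event N \<delta> c) = 0" by (simp add: G_eq)
next
  assume "\<delta> < 1"
  from renormalization_exists[OF assms this] obtain m c0 where
    r: "\<And>c. (\<forall>k\<ge>1. c k > 0) \<and> (\<forall>k\<ge>1. c k \<ge> c0) \<Longrightarrow> renormalization_small N \<delta> c m c0" by blast
  show "\<exists>C :: real. \<forall>c :: nat \<Rightarrow> real. (\<forall>k\<ge>1. c k > 0) \<and> (\<forall>k\<ge>1. c k \<ge> C) \<longrightarrow>
          perc_event N \<delta> c \<in> sets (G N \<delta> c) \<and>
          measure (G N \<delta> c) (perc_event N \<delta> c) > 0 \<and>
          (AE \<omega> in G N \<delta> c. \<forall>x\<in>Omega N. \<forall>y\<in>Omega N.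
              infinite (cluster N \<omega> x) \<and> infinite (cluster N \<omega> y) \<longrightarrow>
              cluster N \<omega> x = cluster N \<omega> y)"
  \<comment> \<open>The threshold depends on \<open>N\<close> and \<open>\<delta>\<close> only, as
    \<open>m\<close> and \<open>c0\<close> were obtained before \<open>c\<close>.\<close>
  proof (intro exI[of _ c0] allI impI)
    fix c :: "nat \<Rightarrow> real" assume "(\<forall>k\<ge>1. c k > 0) \<and> (\<forall>k\<ge>1. c k \<ge> c0)"
    from r[OF this] interpret renormalization_small N \<delta> c m c0 .
    show "perc_event N \<delta> c \<in> sets (G N \<delta> c) \<and>
          measure (G N \<delta> c) (perc_event N \<delta> c) > 0 \<and>
          (AE \<omega> in G N \<delta> c. \<forall>x\<in>Omega N. \<forall>y\<in>Omega N.
              infinite (cluster N \<omega> x) \<and> infinite (cluster N \<omega> y) \<longrightarrow>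
              cluster N \<omega> x = cluster N \<omega> y)"
      using perc_event_sets percolation uniqueness unfolding G_eq by blast
  qed
qed

end
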